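(* Let $n\ge 1$, let $f:\mathbb R^n\to\mathbb R$ be a convex and Lipschitz map with $L=\mathrm{Lip}(f)$, and let $Z\sim N(\mathbf 0,I_n)$. The following are equivalent: (a) for every $t>0$, $\ \mathbb P\big(|f(Z)-\mathrm{med}(f)|\ge tL\big)\ge a_1\exp(-t^2/A_1^2)$; (b) for all $p\ge2$, $\ \big(\mathbb E|f(Z)-\mathrm{med}(f)|^p\big)^{1/p}\ge A_2\sqrt p\,L$; (c) $\ \mathrm{Var}[f(Z)]\ge A_3^2L^2$; where the constants $a_1,A_1,A_2,A_3>0$ depend only on each other. That is, if one of (a), (b), (c) holds with given positive constants, then each of the others holds with positive constants depending only on the given ones (and not on $n$ or $f$).
   Context: $\mathrm{med}(f)$ denotes a median of $f(Z)$, and $\mathrm{Lip}(f)$ is the Lipschitz constant of $f$ with respect to the Euclidean norm. *)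

theory Defs
  imports "HOL-Probability.Probability"
begin

text \<open>
  The dimension is quantified inside the statement (the constants do not depend on it), so points
  of \<open>\<real>\<^sup>n\<close> are functions on the index set \<open>{..<n}\<close>, extended by \<^const>\<open>undefined\<close>; this is the
  underlying set of the product measure \<^const>\<open>PiM\<close> \<open>{..<n}\<close>. Functions \<open>f\<close> on \<open>\<real>\<^sup>n\<close> are total on
  \<^typ>\<open>nat \<Rightarrow> real\<close>, but only their values on \<open>Rn n\<close> matter.
\<close>

definition Rn :: "nat \<Rightarrow> (nat \<Rightarrow> real) set" where
  "Rn n = {..<n} \<rightarrow>\<^sub>E UNIV"

definition convex_Rn :: "nat \<Rightarrow> ((nat \<Rightarrow> real) \<Rightarrow> real) \<Rightarrow> bool" where
  "convex_Rn n f \<longleftrightarrow>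
     (\<forall>x\<in>Rn n. \<forall>y\<in>Rn n. \<forall>u\<in>{0..1}.
        f (\<lambda>i\<in>{..<n}. (1 - u) * x i + u * y i) \<le> (1 - u) * f x + u * f y)"

text \<open>\<^const>\<open>L2_set\<close> of the coordinate differences is the Euclidean distance.\<close>

definition lipschitz_Rn :: "nat \<Rightarrow> real \<Rightarrow> ((nat \<Rightarrow> real) \<Rightarrow> real) \<Rightarrow> bool" where
  "lipschitz_Rn n C f \<longleftrightarrow>
     0 \<le> C \<and> (\<forall>x\<in>Rn n. \<forall>y\<in>Rn n. \<bar>f x - f y\<bar> \<le> C * L2_set (\<lambda>i. x i - y i) {..<n})"

definition Lip :: "nat \<Rightarrow> ((nat \<Rightarrow> real) \<Rightarrow> real) \<Rightarrow> real" where
  "Lip n f = Inf {C. lipschitz_Rn n C f}"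

text \<open>
  The law of \<open>Z\<close>: a standard Gaussian vector has independent standard normal coordinates. In the
  conditions below, \<open>Z\<close> is realised as the identity on this probability space.
\<close>

definition gauss :: "nat \<Rightarrow> (nat \<Rightarrow> real) measure" where
  "gauss n = PiM {..<n} (\<lambda>_. std_normal_distribution)"

definition is_median :: "'a measure \<Rightarrow> ('a \<Rightarrow> real) \<Rightarrow> real \<Rightarrow> bool" where
  "is_median M X m \<longleftrightarrow>
     measure M {x\<in>space M. X x \<le> m} \<ge> 1/2 \<and> measure M {x\<in>space M. X x \<ge> m} \<ge> 1/2"

definition tail_bound :: "nat \<Rightarrow> ((nat \<Rightarrow> real) \<Rightarrow> real) \<Rightarrow> real \<Rightarrow> real \<Rightarrow> real \<Rightarrow> bool" where
  "tail_bound n f m a\<^sub>1 A\<^sub>1 \<longleftrightarrow>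
     (\<forall>t>0. measure (gauss n) {z\<in>space (gauss n). \<bar>f z - m\<bar> \<ge> t * Lip n f}
              \<ge> a\<^sub>1 * exp (- t\<^sup>2 / A\<^sub>1\<^sup>2))"

definition moment_bound :: "nat \<Rightarrow> ((nat \<Rightarrow> real) \<Rightarrow> real) \<Rightarrow> real \<Rightarrow> real \<Rightarrow> bool" where
  "moment_bound n f m A\<^sub>2 \<longleftrightarrow>
     (\<forall>p::real. p \<ge> 2 \<longrightarrow>
        (prob_space.expectation (gauss n) (\<lambda>z. \<bar>f z - m\<bar> powr p)) powr (1 / p)
          \<ge> A\<^sub>2 * sqrt p * Lip n f)"

definition variance_bound :: "nat \<Rightarrow> ((nat \<Rightarrow> real) \<Rightarrow> real) \<Rightarrow> real \<Rightarrow> bool" where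
  "variance_bound n f A\<^sub>3 \<longleftrightarrow> prob_space.variance (gauss n) f \<ge> A\<^sub>3\<^sup>2 * (Lip n f)\<^sup>2"

text \<open>\<open>m\<close> plays the role of \<open>med(f)\<close>.\<close>

definition admissible :: "nat \<Rightarrow> ((nat \<Rightarrow> real) \<Rightarrow> real) \<Rightarrow> real \<Rightarrow> bool" where
  "admissible n f m \<longleftrightarrow>
     n \<ge> 1 \<and> convex_Rn n f \<and> (\<exists>C. lipschitz_Rn n C f) \<and> is_median (gauss n) f m"

end

theory Submission
  imports Defs
begin

text \<open>
  The only hard implication is from (c) to (a). Let \<open>a\<^sup>2 + b\<^sup>2 = 1\<close>, let \<open>X, Y\<close> be independent
  standard Gaussian vectors, so that \<open>a X + b Y\<close> is distributed as \<open>Z\<close>, and let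
  \<open>g x = E f (a x + b Y)\<close>. Convexity of \<open>f\<close> and the Cameron-Martin formula give an explicit
  measurable subgradient \<open>\<xi>\<close> of \<open>g\<close>.

  Writing \<open>g Y - g X\<close> as a telescoping sum over \<open>N\<close> small rotations and letting \<open>N\<close> tend to
  infinity yields a Poincare inequality \<open>Var g \<le> 64 E\<bar>\<xi>\<bar>\<^sup>2\<close>. With
  \<open>Var f = E Var\<^sub>Y f (a X + b Y) + Var g\<close> it shows that \<open>Var f \<le> 128 L\<^sup>2\<close>, and hence, for \<open>b\<close> a
  small multiple of \<open>A\<^sub>3\<close>, that \<open>Var f \<ge> A\<^sub>3\<^sup>2 L\<^sup>2\<close> forces \<open>E\<bar>\<xi>\<bar>\<^sup>2 \<ge> c L\<^sup>2\<close>.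

  Now translate \<open>Y\<close> by \<open>h X = t \<xi> X / L\<close>, a vector of length at most \<open>t\<close>. By convexity this
  increases the mean of \<open>f (a X + b Y)\<close> by at least a multiple of \<open>t L\<close>, while the second moment
  stays of order \<open>t\<^sup>2 L\<^sup>2\<close>, so a deviation of order \<open>t L\<close> occurs with probability bounded below.
  Since \<open>h X\<close> does not depend on \<open>Y\<close>, undoing the translation costs only a factor
  \<open>exp (- K t\<^sup>2)\<close>.
\<close>

section \<open>The one-dimensional Gaussian measure\<close>

text \<open>No constant may depend on \<open>n\<close>, although the squared length of
  \<open>X\<close> has mean of order \<open>n\<close>. A rotation by a small angle \<delta> changes
  \<open>g\<close> mainly through \<delta> times the inner product of \<open>\<xi> X\<close> with
  \<open>Y\<close>, and since \<open>Y\<close> is independent of \<open>X\<close> the second moment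
  of that product is controlled by the mean squared length of \<xi>. Only the radial part, with
  factor \<open>1 - cos \<delta>\<close>, sees \<open>n\<close>; being of second order in \<delta>,
  it disappears in the limit.

  Smoothing serves twice. It supplies a measurable subgradient without differentiating
  \<open>f\<close>, and it separates the vector that selects the translation from the vector that is
  translated. The price is the mean conditional variance. Each conditional function is Lipschitz
  with constant \<open>b L\<close>, so a variance bound uniform over all convex Lipschitz functions
  makes the loss proportional to the square of \<open>b\<close>.

  Deviations are first measured from the mean and only for \<open>t \<ge> 1\<close>. The median lies
  within \<open>16 L\<close> of the mean, so enlarging \<open>t\<close> covers every level around
  the median.\<close>

abbreviation std :: "real measure" where "std \<equiv> std_normal_distribution"

lemma prob_space_std: "prob_space std"
  by (rule prob_space_normal_density) simp

lemma nn_integral_std: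
  assumes [measurable]: "F \<in> borel_measurable borel"
  shows "(\<integral>\<^sup>+x. F x \<partial>std) = (\<integral>\<^sup>+x. ennreal (std_normal_density x) * F x \<partial>lborel)"
  by (simp add: nn_integral_density)

lemma std_normal_density_shift:
  "std_normal_density (z - h) = std_normal_density z * exp (h * z - h\<^sup>2 / 2)"
  unfolding std_normal_density_def
  by (simp add: exp_add[symmetric] power2_eq_square algebra_simps) (simp add: add_divide_distrib diff_divide_distrib algebra_simps)

text \<open>Cameron-Martin in dimension one: a substitution moves the shift onto the density, and
  completing the square turns the shifted density into the old one times the exponential.\<close>

lemma nn_integral_std_shift:
  assumes [measurable]: "F \<in> borel_measurable borel"
  shows "(\<integral>\<^sup>+z. F (z + h) \<partial>std) = (\<integral>\<^sup>+z. F z * ennreal (exp (h * z - h\<^sup>2 / 2)) \<partial>std)"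
proof -
  have "(\<integral>\<^sup>+z. ennreal (std_normal_density (z - h)) * F z \<partial>lborel)
      = (\<integral>\<^sup>+z. ennreal (std_normal_density z) * F (z + h) \<partial>lborel)"
    by (subst nn_integral_real_affine[where c = 1 and t = h]) (auto simp: add.commute one_ennreal_def[symmetric])
  then show ?thesis
    by (simp add: nn_integral_std std_normal_density_shift ennreal_mult' mult_ac)
qed

lemma std_normal_density_rotate:
  assumes "a\<^sup>2 + b\<^sup>2 = 1"
  shows "std_normal_density (a * u - b * v) * std_normal_density (b * u + a * v)
    = std_normal_density u * std_normal_density v"
proof -
  have "(a * u - b * v)\<^sup>2 + (b * u + a * v)\<^sup>2 = (a\<^sup>2 + b\<^sup>2) * (u\<^sup>2 + v\<^sup>2)"
    by algebra
  then have "(a * u - b * v)\<^sup>2 + (b * u + a * v)\<^sup>2 = u\<^sup>2 + v\<^sup>2"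
    using assms by simp
  moreover have "std_normal_density x * std_normal_density y = (1 / sqrt (2 * pi))\<^sup>2 * exp (- (x\<^sup>2 + y\<^sup>2) / 2)" for x y
    unfolding std_normal_density_def
    by (simp add: power2_eq_square exp_add[symmetric] add_divide_distrib diff_divide_distrib)
  ultimately show ?thesis by simp
qed

text \<open>The rotation is factored into two one-variable affine substitutions with Fubini in
  between. Each contributes a factor \<open>a > 0\<close>, and the two cancel; rotation invariance
  of the product density does the rest.\<close>

lemma nn_integral_std_rotate:
  fixes F :: "real \<times> real \<Rightarrow> ennreal"
  assumes [measurable]: "F \<in> borel_measurable (borel \<Otimes>\<^sub>M borel)" and ab: "a\<^sup>2 + b\<^sup>2 = 1" and a: "a > 0"
  shows "(\<integral>\<^sup>+x. \<integral>\<^sup>+y. F (a * x + b * y, a * y - b * x) \<partial>std \<partial>std) = (\<integral>\<^sup>+x. \<integral>\<^sup>+y. F (x, y) \<partial>std \<partial>std)"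
proof -
  let ?s = "\<lambda>x. ennreal (std_normal_density x)"
  have F[measurable]: "F \<in> borel_measurable borel" using assms(1) by (simp add: borel_prod)
  define A where "A = (\<integral>\<^sup>+x. \<integral>\<^sup>+y. ?s x * (?s y * F (a * x + b * y, a * y - b * x)) \<partial>lborel \<partial>lborel)"
  \<comment> \<open>The integrand in mixed coordinates: \<open>u\<close> is the new first
    coordinate, \<open>y\<close> the old second one. \<open>H1\<close> and \<open>H2\<close> recover
    the integrand before and after the rotation.\<close>
  define H where "H = (\<lambda>u y. F (u, (y - b * u) / a) * (?s ((u - b * y) / a) * ?s y))"
  have [measurable]: "(\<lambda>(u, y). H u y) \<in> borel_measurable (borel \<Otimes>\<^sub>M borel)" unfolding H_def by measurable
  have b2: "b * b = 1 - a * a" using ab by (simp add: power2_eq_square algebra_simps)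
  have H1: "H (b * y + a * x) y = ?s x * (?s y * F (a * x + b * y, a * y - b * x))" for x y
  proof -
    have "(y - b * (b * y + a * x)) / a = a * y - b * x" "(b * y + a * x - b * y) / a = x"
      using a b2 by (simp_all add: field_simps) (metis ab distrib_right mult.assoc mult.commute mult_1 power2_eq_square)
    then show ?thesis by (simp add: H_def mult_ac add_ac)
  qed
  have H2: "H u (b * u + a * v) = ?s u * (?s v * F (u, v))" for u v
  proof -
    have "(b * u + a * v - b * u) / a = v" "(u - b * (b * u + a * v)) / a = a * u - b * v"
      using a b2 by (simp_all add: field_simps) (metis ab distrib_right mult.assoc mult.commute mult_1 power2_eq_square)
    then show ?thesis using std_normal_density_rotate[OF ab, of u v]
      by (simp add: H_def mult_ac flip: ennreal_mult')
  qed
  have "A = (\<integral>\<^sup>+y. \<integral>\<^sup>+x. H (b * y + a * x) y \<partial>lborel \<partial>lborel)"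
    unfolding A_def H1 by (rule lborel_pair.Fubini') measurable
  also have "ennreal a * \<dots> = (\<integral>\<^sup>+y. ennreal a * (\<integral>\<^sup>+x. H (b * y + a * x) y \<partial>lborel) \<partial>lborel)"
    by (rule nn_integral_cmult[symmetric]) measurable
  also have "\<dots> = (\<integral>\<^sup>+y. \<integral>\<^sup>+u. H u y \<partial>lborel \<partial>lborel)"
    using a by (intro nn_integral_cong, subst (2) nn_integral_real_affine[where c = a and t = "b * _"]) auto
  also have "\<dots> = (\<integral>\<^sup>+u. \<integral>\<^sup>+y. H u y \<partial>lborel \<partial>lborel)"
    by (rule lborel_pair.Fubini') measurable
  also have "\<dots> = (\<integral>\<^sup>+u. ennreal a * (\<integral>\<^sup>+v. H u (b * u + a * v) \<partial>lborel) \<partial>lborel)"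
    using a by (intro nn_integral_cong, subst nn_integral_real_affine[where c = a and t = "b * _"]) auto
  also have "\<dots> = ennreal a * (\<integral>\<^sup>+u. \<integral>\<^sup>+v. H u (b * u + a * v) \<partial>lborel \<partial>lborel)"
    by (rule nn_integral_cmult) measurable
  finally have "A = (\<integral>\<^sup>+u. \<integral>\<^sup>+v. ?s u * (?s v * F (u, v)) \<partial>lborel \<partial>lborel)"
    using a unfolding H2 by (simp add: ennreal_mult_cancel_left)
  then show ?thesis
    unfolding A_def by (simp add: nn_integral_std nn_integral_cmult)
qed

section \<open>Translations and rotations of the Gaussian vector\<close>

lemma prob_space_gauss: "prob_space (gauss n)"
  unfolding gauss_def by (rule prob_space_PiM) (rule prob_space_std)

lemma space_gauss: "space (gauss n) = Rn n"
  by (simp add: gauss_def Rn_def space_PiM)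

lemma sets_gauss [measurable_cong]: "sets (gauss n) = sets (PiM {..<n} (\<lambda>_. borel))"
  unfolding gauss_def by (rule sets_PiM_cong) auto

lemma measurable_gauss_component [measurable]: "i < n \<Longrightarrow> (\<lambda>x. x i) \<in> borel_measurable (gauss n)"
  by measurable

lemma measurable_into_gauss:
  "(\<And>i. i < n \<Longrightarrow> (\<lambda>w. T w i) \<in> borel_measurable M) \<Longrightarrow> (\<lambda>w. \<lambda>i\<in>{..<n}. T w i) \<in> M \<rightarrow>\<^sub>M gauss n"
  by (subst measurable_cong_sets[OF refl sets_gauss]) (rule measurable_restrict, auto)

lemma product_sigma_finite_std: "product_sigma_finite (\<lambda>_. std)"
  by standard (rule prob_space_imp_sigma_finite[OF prob_space_std, THEN sigma_finite_measure.sigma_finite_countable])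

lemma nn_integral_gauss_prod:
  assumes "\<And>i. i < n \<Longrightarrow> f i \<in> borel_measurable borel"
  shows "(\<integral>\<^sup>+x. (\<Prod>i<n. f i (x i)) \<partial>gauss n) = (\<Prod>i<n. \<integral>\<^sup>+x. f i x \<partial>std)"
  unfolding gauss_def using assms
  by (intro product_sigma_finite.product_nn_integral_prod product_sigma_finite_std) auto

lemma emeasure_distr_nn_integral:
  assumes "T \<in> M \<rightarrow>\<^sub>M N" "B \<in> sets N"
  shows "emeasure (distr M N T) B = (\<integral>\<^sup>+x. indicator B (T x) \<partial>M)"
  using nn_integral_distr[OF assms(1), of "indicator B"] assms(2) by simp

definition ip :: "nat \<Rightarrow> (nat \<Rightarrow> real) \<Rightarrow> (nat \<Rightarrow> real) \<Rightarrow> real" where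
  "ip n x y = (\<Sum>i<n. x i * y i)"

lemma measurable_ip [measurable]:
  assumes "\<And>i. i < n \<Longrightarrow> (\<lambda>w. S w i) \<in> borel_measurable M" "\<And>i. i < n \<Longrightarrow> (\<lambda>w. T w i) \<in> borel_measurable M"
  shows "(\<lambda>w. ip n (S w) (T w)) \<in> borel_measurable M"
  unfolding ip_def using assms by measurable

text \<open>Cameron-Martin formula. On a box both sides factor into one-dimensional integrals, which
  \<open>nn_integral_std_shift\<close> matches, and boxes determine a finite measure on the
  product.\<close>

lemma distr_gauss_shift:
  "distr (gauss n) (gauss n) (\<lambda>x. \<lambda>i\<in>{..<n}. x i + h i)
     = density (gauss n) (\<lambda>x. ennreal (exp (ip n h x - ip n h h / 2)))" (is "?D = ?E")
proof -
  have T[measurable]: "(\<lambda>x. \<lambda>i\<in>{..<n}. x i + h i) \<in> gauss n \<rightarrow>\<^sub>M gauss n"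
    by (rule measurable_into_gauss) measurable
  have box: "Pi\<^sub>E {..<n} A \<in> sets (gauss n)" if "\<And>i. i \<in> {..<n} \<Longrightarrow> A i \<in> sets borel" for A
    unfolding sets_gauss using that by (intro sets_PiM_I_finite) auto
  have D: "emeasure ?D (Pi\<^sub>E {..<n} A) = (\<Prod>i<n. \<integral>\<^sup>+z. indicator (A i) (z + h i) \<partial>std)"
    if A: "\<And>i. i \<in> {..<n} \<Longrightarrow> A i \<in> sets borel" for A
  proof -
    have "emeasure ?D (Pi\<^sub>E {..<n} A) = (\<integral>\<^sup>+x. indicator (Pi\<^sub>E {..<n} A) (\<lambda>i\<in>{..<n}. x i + h i) \<partial>gauss n)"
      by (rule emeasure_distr_nn_integral[OF T box[OF A]])
    also have "\<dots> = (\<integral>\<^sup>+x. (\<Prod>i<n. indicator (A i) (x i + h i)) \<partial>gauss n)"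
      by (intro nn_integral_cong) (auto simp: indicator_def PiE_iff prod_zero_iff split: if_splits)
    also have "\<dots> = (\<Prod>i<n. \<integral>\<^sup>+z. indicator (A i) (z + h i) \<partial>std)"
      using A by (intro nn_integral_gauss_prod) auto
    finally show ?thesis .
  qed
  have E: "emeasure ?E (Pi\<^sub>E {..<n} A) = (\<Prod>i<n. \<integral>\<^sup>+z. indicator (A i) (z + h i) \<partial>std)"
    if A: "\<And>i. i \<in> {..<n} \<Longrightarrow> A i \<in> sets borel" for A
  proof -
    have "emeasure ?E (Pi\<^sub>E {..<n} A) = (\<integral>\<^sup>+x. ennreal (exp (ip n h x - ip n h h / 2)) * indicator (Pi\<^sub>E {..<n} A) x \<partial>gauss n)"
      using box[OF A] by (intro emeasure_density) auto
    also have "\<dots> = (\<integral>\<^sup>+x. (\<Prod>i<n. indicator (A i) (x i) * ennreal (exp (h i * x i - (h i)\<^sup>2 / 2))) \<partial>gauss n)"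
    proof (rule nn_integral_cong)
      fix x assume "x \<in> space (gauss n)"
      then have "indicator (Pi\<^sub>E {..<n} A) x = (\<Prod>i<n. indicator (A i) (x i) :: ennreal)"
        by (auto simp: indicator_def PiE_iff prod_zero_iff space_gauss Rn_def split: if_splits)
      moreover have "ennreal (exp (ip n h x - ip n h h / 2)) = (\<Prod>i<n. ennreal (exp (h i * x i - (h i)\<^sup>2 / 2)))"
        by (subst prod_ennreal) (auto simp: exp_sum[symmetric] ip_def sum_subtractf sum_divide_distrib power2_eq_square)
      ultimately show "ennreal (exp (ip n h x - ip n h h / 2)) * indicator (Pi\<^sub>E {..<n} A) x
          = (\<Prod>i<n. indicator (A i) (x i) * ennreal (exp (h i * x i - (h i)\<^sup>2 / 2)))"
        by (simp add: prod.distrib mult.commute)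
    qed
    also have "\<dots> = (\<Prod>i<n. \<integral>\<^sup>+z. indicator (A i) z * ennreal (exp (h i * z - (h i)\<^sup>2 / 2)) \<partial>std)"
      using A by (intro nn_integral_gauss_prod) auto
    also have "\<dots> = (\<Prod>i<n. \<integral>\<^sup>+z. indicator (A i) (z + h i) \<partial>std)"
      using A by (intro prod.cong refl nn_integral_std_shift[symmetric]) auto
    finally show ?thesis .
  qed
  interpret D: prob_space ?D
    by (rule prob_space.prob_space_distr[OF prob_space_gauss]) measurable
  show ?thesis
  proof (rule measure_eqI_PiM_finite[where I = "{..<n}" and M = "\<lambda>_. borel" and A = "\<lambda>_. space (PiM {..<n} (\<lambda>_. borel))"])
    show "sets ?D = sets (PiM {..<n} (\<lambda>_. borel))" "sets ?E = sets (PiM {..<n} (\<lambda>_. borel))"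
      by (simp_all add: sets_gauss)
    show "emeasure ?D (Pi\<^sub>E {..<n} A) = emeasure ?E (Pi\<^sub>E {..<n} A)"
      if "\<And>i. i \<in> {..<n} \<Longrightarrow> A i \<in> sets borel" for A
      using D[of A] E[of A] that by simp
    show "range (\<lambda>_. space (PiM {..<n} (\<lambda>_. borel))) \<subseteq> prod_algebra {..<n} (\<lambda>_. borel)"
      by (auto simp: space_PiM intro!: prod_algebraI_finite)
    show "(\<Union>i::nat. space (PiM {..<n} (\<lambda>_. borel))) = space (PiM {..<n} (\<lambda>_. borel :: real measure))" by auto
    show "emeasure ?D (space (PiM {..<n} (\<lambda>_. borel))) \<noteq> \<infinity>" for i :: nat by simp
  qed simp
qed

definition rot :: "nat \<Rightarrow> real \<Rightarrow> real \<Rightarrow> (nat \<Rightarrow> real) \<times> (nat \<Rightarrow> real) \<Rightarrow> (nat \<Rightarrow> real) \<times> (nat \<Rightarrow> real)" where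
  "rot n a b p = (\<lambda>i\<in>{..<n}. a * fst p i + b * snd p i, \<lambda>i\<in>{..<n}. a * snd p i - b * fst p i)"

lemma measurable_rot [measurable]:
  "rot n a b \<in> gauss n \<Otimes>\<^sub>M gauss n \<rightarrow>\<^sub>M gauss n \<Otimes>\<^sub>M gauss n"
  unfolding rot_def[abs_def] by (intro measurable_Pair measurable_into_gauss) measurable

text \<open>The rotation mixes the \<open>i\<close>-th coordinates of the two vectors, so the pair
  of vectors is regrouped as \<open>n\<close> independent planar pairs with law \<open>G\<close>,
  where planar invariance applies factor by factor. \<open>K\<close> rotates and regroups,
  \<open>J\<close> undoes the regrouping; \<open>K 1 0\<close> is regrouping alone and shows that
  \<open>J\<close> carries \<open>G\<close> back to the law of the pair.\<close>

lemma distr_gauss_pair_rotate: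
  assumes ab: "a\<^sup>2 + b\<^sup>2 = 1" and a: "a > 0"
  shows "distr (gauss n \<Otimes>\<^sub>M gauss n) (gauss n \<Otimes>\<^sub>M gauss n) (rot n a b) = gauss n \<Otimes>\<^sub>M gauss n"
proof -
  let ?N = "gauss n \<Otimes>\<^sub>M gauss n"
  interpret g: prob_space "gauss n" by (rule prob_space_gauss)
  interpret s: prob_space std by (rule prob_space_std)
  interpret ss: pair_prob_space std std ..
  interpret gg: pair_prob_space "gauss n" "gauss n" ..
  define G where "G = PiM {..<n} (\<lambda>_. std \<Otimes>\<^sub>M std)"
  have sG: "sets G = sets (PiM {..<n} (\<lambda>_. borel \<Otimes>\<^sub>M borel))"
    unfolding G_def by (rule sets_PiM_cong) (auto intro: sets_pair_measure_cong)
  define K where "K c d p = (\<lambda>i\<in>{..<n}. (c * fst p i + d * snd p i, c * snd p i - d * fst p i))"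
    for c d and p :: "(nat \<Rightarrow> real) \<times> (nat \<Rightarrow> real)"
  define J where "J w = (\<lambda>i\<in>{..<n}. fst (w i), \<lambda>i\<in>{..<n}. snd (w i))" for w :: "nat \<Rightarrow> real \<times> real"
  have K[measurable]: "K c d \<in> ?N \<rightarrow>\<^sub>M G" for c d
    unfolding K_def[abs_def] measurable_cong_sets[OF refl sG] by (rule measurable_restrict) measurable
  have J[measurable]: "J \<in> G \<rightarrow>\<^sub>M ?N"
    unfolding J_def[abs_def] measurable_cong_sets[OF sG refl]
    by (intro measurable_Pair measurable_into_gauss) measurable
  have dK: "distr ?N G (K c d) = G" if cd: "c\<^sup>2 + d\<^sup>2 = 1" "c > 0" for c d
    unfolding G_def
  proof (rule product_sigma_finite.PiM_eqI)
    show "product_sigma_finite (\<lambda>_::nat. std \<Otimes>\<^sub>M std)" ..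
    fix A assume "\<And>i. i \<in> {..<n} \<Longrightarrow> A i \<in> sets (std \<Otimes>\<^sub>M std)"
    then have A[measurable]: "i < n \<Longrightarrow> A i \<in> sets (borel \<Otimes>\<^sub>M borel)" for i
      using sets_pair_measure_cong[of std borel std borel] by auto
    have "Pi\<^sub>E {..<n} A \<in> sets G"
      unfolding sG using A by (intro sets_PiM_I_finite) auto
    then have "emeasure (distr ?N (PiM {..<n} (\<lambda>_. std \<Otimes>\<^sub>M std)) (K c d)) (Pi\<^sub>E {..<n} A)
        = (\<integral>\<^sup>+p. indicator (Pi\<^sub>E {..<n} A) (K c d p) \<partial>?N)"
      using K[of c d] unfolding G_def by (intro emeasure_distr_nn_integral)
    also have "\<dots> = (\<integral>\<^sup>+p. (\<Prod>i<n. indicator (A i) (c * fst p i + d * snd p i, c * snd p i - d * fst p i)) \<partial>?N)"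
      by (intro nn_integral_cong) (auto simp: K_def indicator_def PiE_iff prod_zero_iff split: if_splits)
    also have "\<dots> = (\<integral>\<^sup>+x. \<integral>\<^sup>+y. (\<Prod>i<n. indicator (A i) (c * x i + d * y i, c * y i - d * x i)) \<partial>gauss n \<partial>gauss n)"
      by (subst g.nn_integral_fst[symmetric]) auto
    also have "\<dots> = (\<integral>\<^sup>+x. (\<Prod>i<n. \<integral>\<^sup>+v. indicator (A i) (c * x i + d * v, c * v - d * x i) \<partial>std) \<partial>gauss n)"
      by (intro nn_integral_cong nn_integral_gauss_prod) measurable
    also have "\<dots> = (\<Prod>i<n. \<integral>\<^sup>+u. \<integral>\<^sup>+v. indicator (A i) (c * u + d * v, c * v - d * u) \<partial>std \<partial>std)"
      by (intro nn_integral_gauss_prod) measurable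
    also have "\<dots> = (\<Prod>i<n. \<integral>\<^sup>+u. \<integral>\<^sup>+v. indicator (A i) (u, v) \<partial>std \<partial>std)"
      using cd by (intro prod.cong refl nn_integral_std_rotate) auto
    also have "\<dots> = (\<Prod>i\<in>{..<n}. emeasure (std \<Otimes>\<^sub>M std) (A i))"
      using A by (intro prod.cong refl) (subst s.emeasure_pair_measure, auto)
    finally show "emeasure (distr ?N (PiM {..<n} (\<lambda>_. std \<Otimes>\<^sub>M std)) (K c d)) (Pi\<^sub>E {..<n} A)
      = (\<Prod>i\<in>{..<n}. emeasure (std \<Otimes>\<^sub>M std) (A i))" .
  qed simp_all
  have "distr G ?N J = distr (distr ?N G (K 1 0)) ?N J" by (subst dK) auto
  also have "\<dots> = distr ?N ?N (J \<circ> K 1 0)"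
    by (rule distr_distr) measurable
  also have "\<dots> = distr ?N ?N (\<lambda>p. p)"
  proof (rule distr_cong[OF refl refl])
    fix p assume "p \<in> space ?N"
    then show "(J \<circ> K 1 0) p = p"
      by (cases p) (auto simp: J_def K_def fun_eq_iff space_pair_measure space_gauss Rn_def PiE_def extensional_def)
  qed
  also have "\<dots> = ?N" by (rule distr_id)
  finally have "?N = distr (distr ?N G (K a b)) ?N J" using dK[OF ab a] by simp
  also have "\<dots> = distr ?N ?N (rot n a b)"
    by (subst distr_distr) (auto intro!: distr_cong simp: J_def K_def comp_def rot_def fun_eq_iff restrict_def)
  finally show ?thesis by simp
qed

section \<open>Convex Lipschitz functions and Gaussian moments\<close>

text \<open>\<^const>\<open>L2_set\<close> over \<open>{..<n}\<close> makes \<open>F\<close> depend on the first \<open>n\<close> coordinates only, so \<open>F\<close> may be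
  applied to pointwise combinations that are not extensional.\<close>

definition convex_lip :: "nat \<Rightarrow> real \<Rightarrow> ((nat \<Rightarrow> real) \<Rightarrow> real) \<Rightarrow> bool" where
  "convex_lip n L F \<longleftrightarrow> 0 \<le> L \<and> (\<forall>x y. \<bar>F x - F y\<bar> \<le> L * L2_set (\<lambda>i. x i - y i) {..<n}) \<and>
     (\<forall>x y. \<forall>u\<in>{0..1}. F (\<lambda>i. (1 - u) * x i + u * y i) \<le> (1 - u) * F x + u * F y)"

lemma convex_lipD:
  assumes "convex_lip n L F"
  shows "0 \<le> L" "\<bar>F x - F y\<bar> \<le> L * L2_set (\<lambda>i. x i - y i) {..<n}"
    "0 \<le> u \<Longrightarrow> u \<le> 1 \<Longrightarrow> F (\<lambda>i. (1 - u) * x i + u * y i) \<le> (1 - u) * F x + u * F y"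
  using assms by (auto simp: convex_lip_def)

lemma convex_lip_cong:
  assumes "convex_lip n L F" "\<And>i. i < n \<Longrightarrow> x i = y i"
  shows "F x = F y"
proof -
  have "L2_set (\<lambda>i. x i - y i) {..<n} = 0" using assms(2) by (simp add: L2_set_def)
  then show ?thesis using convex_lipD(2)[OF assms(1), of x y] by simp
qed

lemma convex_lip_restrict [simp]:
  "convex_lip n L F \<Longrightarrow> F (restrict x {..<n}) = F x"
  by (erule convex_lip_cong) simp

lemma convex_lip_measurable:
  assumes F: "convex_lip n L F" and T: "\<And>i. i < n \<Longrightarrow> (\<lambda>w. T w i) \<in> borel_measurable M"
  shows "(\<lambda>w. F (T w)) \<in> borel_measurable M"
proof -
  have "continuous_on UNIV F"
    unfolding continuous_on_def
  proof
    fix x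
    have "isCont (\<lambda>y. y i :: real) x" for i :: nat
      using continuous_on_product_coordinates[of i]
      by (metis UNIV_I continuous_on_eq_continuous_at open_UNIV)
    then have "isCont (\<lambda>y. L * L2_set (\<lambda>i. y i - x i) {..<n}) x"
      unfolding L2_set_def by (intro continuous_intros)
    then have "((\<lambda>y. L * L2_set (\<lambda>i. y i - x i) {..<n}) \<longlongrightarrow> 0) (at x)"
      by (simp add: isCont_def L2_set_def)
    then have "((\<lambda>y. F y - F x) \<longlongrightarrow> 0) (at x)"
      by (rule Lim_null_comparison[rotated]) (use convex_lipD(2)[OF F, of _ x] in auto)
    then show "(F \<longlongrightarrow> F x) (at x)" by (rule LIM_zero_cancel)
  qed
  then have F': "F \<in> borel_measurable borel" by (rule borel_measurable_continuous_onI)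
  \<comment> \<open>Measurability of \<open>T\<close> is known only at indices below
    \<open>n\<close>; the other coordinates are replaced by 0, which \<open>F\<close> does not
    see.\<close>
  have "(\<lambda>w. \<lambda>i. if i < n then T w i else 0) \<in> borel_measurable M"
  proof (rule measurable_coordinatewise_then_product)
    show "(\<lambda>w. if i < n then T w i else 0) \<in> borel_measurable M" for i
      using T by (cases "i < n") auto
  qed
  from measurable_compose[OF this F'] show ?thesis
    by (rule measurable_cong[THEN iffD1, rotated]) (rule convex_lip_cong[OF F], simp)
qed

text \<open>The sum norm rather than the Euclidean one: \<open>exp (c * l1 n x)\<close> is a product
  of one-variable functions, hence integrable for every \<open>c\<close>. It is the standard
  dominating function below.\<close>

abbreviation l1 :: "nat \<Rightarrow> (nat \<Rightarrow> real) \<Rightarrow> real" where "l1 n x \<equiv> (\<Sum>i<n. \<bar>x i\<bar>)"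

lemma ip_commute: "ip n x y = ip n y x" by (simp add: ip_def mult.commute)

lemma ip_add_right: "ip n x (\<lambda>i. y i + z i) = ip n x y + ip n x z"
  by (simp add: ip_def sum.distrib algebra_simps)

lemma ip_scale_right: "ip n x (\<lambda>i. c * y i) = c * ip n x y"
  by (simp add: ip_def sum_distrib_left algebra_simps)

lemma ip_scale_left: "ip n (\<lambda>i. c * x i) y = c * ip n x y"
  by (simp add: ip_def sum_distrib_left algebra_simps)

lemma ip_self_nonneg [simp]: "0 \<le> ip n x x" by (simp add: ip_def sum_nonneg)

lemma L2_set_ip: "L2_set x {..<n} = sqrt (ip n x x)"
  by (simp add: L2_set_def ip_def power2_eq_square)

lemma ip_self_L2_set: "ip n x x = (L2_set x {..<n})\<^sup>2"
  by (simp add: L2_set_ip)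

lemma abs_ip_le: "\<bar>ip n x y\<bar> \<le> L2_set x {..<n} * L2_set y {..<n}"
proof -
  have "\<bar>ip n x y\<bar> \<le> (\<Sum>i<n. \<bar>x i\<bar> * \<bar>y i\<bar>)"
    unfolding ip_def by (rule order_trans[OF sum_abs]) (simp add: abs_mult)
  also have "\<dots> \<le> L2_set x {..<n} * L2_set y {..<n}" by (rule L2_set_mult_ineq)
  finally show ?thesis .
qed

lemma ip_self_le_iff: "0 \<le> r \<Longrightarrow> L2_set x {..<n} \<le> r \<longleftrightarrow> ip n x x \<le> r\<^sup>2"
  unfolding ip_self_L2_set by (simp add: power2_le_iff_abs_le)

lemma abs_ip_l1: "\<bar>ip n h x\<bar> \<le> l1 n h * l1 n x"
proof -
  have "\<bar>ip n h x\<bar> \<le> (\<Sum>i<n. \<bar>h i\<bar> * \<bar>x i\<bar>)"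
    unfolding ip_def by (rule order_trans[OF sum_abs]) (simp add: abs_mult)
  also have "\<dots> \<le> (\<Sum>i<n. l1 n h * \<bar>x i\<bar>)"
    by (intro sum_mono mult_right_mono member_le_sum) auto
  finally show ?thesis by (simp add: sum_distrib_left)
qed

lemma L2_set_le_l1: "L2_set x {..<n} \<le> l1 n x"
  by (rule L2_set_le_sum_abs)

lemma self_le_exp: "(x::real) \<le> exp x"
  using exp_ge_add_one_self[of x] by linarith

lemma convex_lip_growth:
  assumes "convex_lip n L F"
  shows "\<bar>F x\<bar> \<le> exp (\<bar>F (\<lambda>_. 0)\<bar> + L * l1 n x)"
proof -
  have "\<bar>F x\<bar> \<le> \<bar>F (\<lambda>_. 0)\<bar> + L * L2_set x {..<n}"
    using convex_lipD(2)[OF assms, of x "\<lambda>_. 0"] by simp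
  also have "\<dots> \<le> \<bar>F (\<lambda>_. 0)\<bar> + L * l1 n x"
    using convex_lipD(1)[OF assms] L2_set_le_l1[of x n] by (simp add: mult_left_mono)
  finally show ?thesis using self_le_exp order_trans by blast
qed

section \<open>Exponential integrability and second moments of linear forms\<close>

lemma integrable_std_exp_abs: "integrable std (\<lambda>z. exp (c * \<bar>z\<bar>))"
proof -
  have e: "integrable std (\<lambda>z. exp (h * z))" for h
  proof -
    have "(\<integral>\<^sup>+z. ennreal (exp (h * z - h\<^sup>2 / 2)) \<partial>std) = (\<integral>\<^sup>+z. 1 \<partial>std)"
      using nn_integral_std_shift[of "\<lambda>_. 1" h] by simp
    also have "\<dots> < \<infinity>" using prob_space.emeasure_space_1[OF prob_space_std] by simp
    finally have "integrable std (\<lambda>z. exp (h * z - h\<^sup>2 / 2))"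
      by (intro integrableI_bounded) auto
    then have "integrable std (\<lambda>z. exp (h\<^sup>2 / 2) * exp (h * z - h\<^sup>2 / 2))"
      by (rule integrable_mult_right)
    then show ?thesis by (simp add: exp_add[symmetric])
  qed
  show ?thesis
  proof (rule Bochner_Integration.integrable_bound[OF Bochner_Integration.integrable_add[OF e[of c] e[of "-c"]]])
    have "norm (exp (c * \<bar>z\<bar>)) \<le> norm (exp (c * z) + exp (- c * z))" for z
    proof -
      have "norm (exp (c * z) + exp (- c * z)) = exp (c * z) + exp (- c * z)"
        by (simp add: add_nonneg_nonneg)
      then show ?thesis by (cases "z \<ge> 0") auto
    qed
    then show "AE z in std. norm (exp (c * \<bar>z\<bar>)) \<le> norm (exp (c * z) + exp (- c * z))" by simp
  qed simp
qed

lemma integrable_gauss_exp_l1: "integrable (gauss n) (\<lambda>x. exp (c * l1 n x))"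
proof -
  have "integrable (gauss n) (\<lambda>x. \<Prod>i<n. exp (c * \<bar>x i\<bar>))"
    unfolding gauss_def
    by (intro product_sigma_finite.product_integrable_prod product_sigma_finite_std integrable_std_exp_abs) auto
  then show ?thesis by (simp add: exp_sum[symmetric] sum_distrib_left)
qed

lemma integrable_gaussI:
  assumes "f \<in> borel_measurable (gauss n)" "\<And>x. \<bar>f x\<bar> \<le> exp (C + c * l1 n x)"
  shows "integrable (gauss n) f"
proof (rule Bochner_Integration.integrable_bound)
  show "integrable (gauss n) (\<lambda>x. exp C * exp (c * l1 n x))"
    by (intro integrable_mult_right integrable_gauss_exp_l1)
qed (use assms in \<open>auto simp: exp_add\<close>)

lemma gauss_shift_integral:
  fixes f :: "_ \<Rightarrow> real"
  assumes [measurable]: "f \<in> borel_measurable (gauss n)"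
  shows "(\<integral>x. f (\<lambda>i\<in>{..<n}. x i + h i) \<partial>gauss n) = (\<integral>x. exp (ip n h x - ip n h h / 2) * f x \<partial>gauss n)"
proof -
  have "(\<integral>x. f (\<lambda>i\<in>{..<n}. x i + h i) \<partial>gauss n) = (\<integral>x. f x \<partial>distr (gauss n) (gauss n) (\<lambda>x. \<lambda>i\<in>{..<n}. x i + h i))"
    by (subst integral_distr) (auto intro!: measurable_into_gauss)
  then show ?thesis
    unfolding distr_gauss_shift by (simp add: integral_real_density)
qed

lemma integrable_exp_ip: "integrable (gauss n) (\<lambda>x. exp (ip n h x))"
proof (rule integrable_gaussI)
  show "\<bar>exp (ip n h x)\<bar> \<le> exp (0 + l1 n h * l1 n x)" for x
    using abs_ip_l1[of n h x] by simp
qed measurable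

lemma integral_exp_ip: "(\<integral>x. exp (ip n h x) \<partial>gauss n) = exp (ip n h h / 2)"
proof -
  interpret g: prob_space "gauss n" by (rule prob_space_gauss)
  have "1 = (\<integral>x. exp (ip n h x - ip n h h / 2) \<partial>gauss n)"
    using gauss_shift_integral[of "\<lambda>_. 1" n h] g.prob_space by simp
  also have "\<dots> = (\<integral>x. exp (- ip n h h / 2) * exp (ip n h x) \<partial>gauss n)"
    by (simp add: exp_add[symmetric])
  also have "\<dots> = exp (- ip n h h / 2) * (\<integral>x. exp (ip n h x) \<partial>gauss n)" by simp
  finally show ?thesis by (simp add: exp_minus field_simps)
qed

lemma square_le_exp: "(y::real)\<^sup>2 \<le> 2 * exp \<bar>y\<bar>"
  using exp_lower_Taylor_quadratic[of "\<bar>y\<bar>"] by simp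

lemma integrable_ip_square: "integrable (gauss n) (\<lambda>x. (ip n h x)\<^sup>2)"
proof (rule integrable_gaussI)
  show "(\<lambda>x. (ip n h x)\<^sup>2) \<in> borel_measurable (gauss n)" by measurable
  show "\<bar>(ip n h x)\<^sup>2\<bar> \<le> exp (1 + l1 n h * l1 n x)" for x
  proof -
    have "(ip n h x)\<^sup>2 \<le> exp 1 * exp \<bar>ip n h x\<bar>"
    proof -
      have "2 * exp \<bar>ip n h x\<bar> \<le> exp 1 * exp \<bar>ip n h x\<bar>"
        using exp_ge_add_one_self[of 1] by (intro mult_right_mono) auto
      then show ?thesis using square_le_exp[of "ip n h x"] by linarith
    qed
    also have "\<dots> \<le> exp (1 + l1 n h * l1 n x)" using abs_ip_l1[of n h x] by (simp add: exp_add[symmetric])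
    finally show ?thesis by simp
  qed
qed

text \<open>The exact value is \<open>ip n h h\<close>; the factor 8 is the price of using
  exponential moments only. After normalising \<open>h\<close> to length one,
  \<open>y\<^sup>2 \<le> 2 * exp \<bar>y\<bar>\<close> bounds the integral by
  \<open>4 * exp (1 / 2)\<close>, which is at most 8.\<close>

lemma integral_ip_square_le: "(\<integral>x. (ip n h x)\<^sup>2 \<partial>gauss n) \<le> 8 * ip n h h"
proof (cases "ip n h h = 0")
  case True
  then have "ip n h x = 0" for x
    using abs_ip_le[of n h x] by (simp add: L2_set_ip)
  then show ?thesis by simp
next
  case False
  define q where "q = ip n h h"
  have q: "q > 0" using False ip_self_nonneg[of n h] unfolding q_def by linarith
  define k where "k i = h i / sqrt q" for i
  have k: "ip n k x = ip n h x / sqrt q" for x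
    unfolding k_def ip_def by (simp add: sum_divide_distrib)
  have "ip n k k = ip n h k / sqrt q" by (rule k)
  also have "ip n h k = q / sqrt q" using k[of h] ip_commute[of n h k] q_def by simp
  finally have kk: "ip n k k = 1" using q by (simp add: real_div_sqrt)
  have "(ip n k x)\<^sup>2 \<le> 2 * exp (ip n k x) + 2 * exp (ip n (\<lambda>i. - k i) x)" for x
  proof -
    have "ip n (\<lambda>i. - k i) x = - ip n k x" by (simp add: ip_def sum_negf)
    moreover have "exp \<bar>ip n k x\<bar> \<le> exp (ip n k x) + exp (- ip n k x)" by (simp add: abs_if)
    ultimately show ?thesis using square_le_exp[of "ip n k x"] by simp
  qed
  then have "(\<integral>x. (ip n k x)\<^sup>2 \<partial>gauss n) \<le> (\<integral>x. 2 * exp (ip n k x) + 2 * exp (ip n (\<lambda>i. - k i) x) \<partial>gauss n)"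
    by (intro integral_mono integrable_ip_square Bochner_Integration.integrable_add integrable_mult_right integrable_exp_ip)
  also have "\<dots> = 4 * exp (1 / 2)"
  proof -
    have "ip n (\<lambda>i. - k i) (\<lambda>i. - k i) = 1" using kk by (simp only: ip_def minus_mult_minus)
    then have "(\<integral>x. 2 * exp (ip n k x) \<partial>gauss n) = 2 * exp (1 / 2)"
      "(\<integral>x. 2 * exp (ip n (\<lambda>i. - k i) x) \<partial>gauss n) = 2 * exp (1 / 2)"
      using kk by (simp_all only: integral_mult_right_zero integral_exp_ip)
    then show ?thesis
      by (subst Bochner_Integration.integral_add) (auto intro!: integrable_mult_right integrable_exp_ip)
  qed
  also have "\<dots> \<le> 8"
    using exp_bound_half[of "1/2::real"] by simp
  finally have "(\<integral>x. (ip n h x)\<^sup>2 / q \<partial>gauss n) \<le> 8"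
    using q by (simp add: k power_divide)
  then show ?thesis using q by (simp add: q_def[symmetric] field_simps)
qed

lemma integrable_ip_self: "integrable (gauss n) (\<lambda>x. ip n x x)"
  and integral_ip_self_le: "(\<integral>x. ip n x x \<partial>gauss n) \<le> 8 * n"
proof -
  define e where "e i j = (if i = j then 1 else 0 :: real)" for i j :: nat
  have e: "ip n (e i) x = x i" "ip n (e i) (e i) = 1" if "i < n" for i x
    using that by (simp_all add: ip_def e_def if_distrib[where f = "\<lambda>t. t * _"] sum.delta cong: if_cong)
  have eq: "ip n x x = (\<Sum>i<n. (ip n (e i) x)\<^sup>2)" for x
    using e by (simp add: ip_def power2_eq_square)
  show "integrable (gauss n) (\<lambda>x. ip n x x)"
    unfolding eq by (intro Bochner_Integration.integrable_sum integrable_ip_square)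
  have "(\<integral>x. ip n x x \<partial>gauss n) = (\<Sum>i<n. \<integral>x. (ip n (e i) x)\<^sup>2 \<partial>gauss n)"
    unfolding eq by (intro Bochner_Integration.integral_sum integrable_ip_square)
  also have "\<dots> \<le> (\<Sum>i<n. 8)"
  proof (rule sum_mono)
    fix i assume "i \<in> {..<n}"
    then show "(\<integral>x. (ip n (e i) x)\<^sup>2 \<partial>gauss n) \<le> 8"
      using integral_ip_square_le[of n "e i"] e(2)[of i] by simp
  qed
  finally show "(\<integral>x. ip n x x \<partial>gauss n) \<le> 8 * n" by simp
qed

section \<open>Gaussian smoothing and its gradient\<close>

lemma convex_lip_affine:
  assumes F: "convex_lip n L F"
  shows "convex_lip n (L * \<bar>c\<bar>) (\<lambda>x. F (\<lambda>i. w i + c * x i))"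
  unfolding convex_lip_def
proof (intro conjI allI ballI)
  show "0 \<le> L * \<bar>c\<bar>" using convex_lipD(1)[OF F] by simp
  fix x y :: "nat \<Rightarrow> real"
  have "L2_set (\<lambda>i. (w i + c * x i) - (w i + c * y i)) {..<n} = \<bar>c\<bar> * L2_set (\<lambda>i. x i - y i) {..<n}"
    by (simp add: L2_set_def right_diff_distrib[symmetric] power_mult_distrib sum_distrib_left[symmetric] real_sqrt_mult)
  then show "\<bar>F (\<lambda>i. w i + c * x i) - F (\<lambda>i. w i + c * y i)\<bar> \<le> L * \<bar>c\<bar> * L2_set (\<lambda>i. x i - y i) {..<n}"
    using convex_lipD(2)[OF F, of "\<lambda>i. w i + c * x i" "\<lambda>i. w i + c * y i"] by simp
  fix u :: real assume u: "u \<in> {0..1}"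
  have "(\<lambda>i. w i + c * ((1 - u) * x i + u * y i)) = (\<lambda>i. (1 - u) * (w i + c * x i) + u * (w i + c * y i))"
    by (simp add: fun_eq_iff algebra_simps)
  then show "F (\<lambda>i. w i + c * ((1 - u) * x i + u * y i)) \<le> (1 - u) * F (\<lambda>i. w i + c * x i) + u * F (\<lambda>i. w i + c * y i)"
    using convex_lipD(3)[OF F, of u "\<lambda>i. w i + c * x i" "\<lambda>i. w i + c * y i"] u by simp
qed

lemma convex_lip_measurable_gauss:
  "convex_lip n L F \<Longrightarrow> F \<in> borel_measurable (gauss n)"
  using convex_lip_measurable[of n L F "\<lambda>x. x" "gauss n"] by simp

lemma integrable_convex_lip:
  assumes F: "convex_lip n L F"
  shows "integrable (gauss n) F"
  by (rule integrable_gaussI[OF convex_lip_measurable_gauss[OF F] convex_lip_growth[OF F]])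

lemma integrable_convex_lip_shift:
  assumes F: "convex_lip n L F"
  shows "integrable (gauss n) (\<lambda>x. F (\<lambda>i. x i + h i))"
  using integrable_convex_lip[OF convex_lip_affine[OF F, of 1 h]] by (simp add: add.commute)

lemma abs_exp_minus_one_le: "\<bar>exp u - 1\<bar> \<le> \<bar>u\<bar> * exp \<bar>u::real\<bar>"
proof (cases "u \<ge> 0")
  case True
  have "1 - u \<le> exp (-u)" using exp_ge_add_one_self[of "-u"] by simp
  then have "(1 - u) * exp u \<le> exp (-u) * exp u" by (rule mult_right_mono) simp
  then show ?thesis using True by (simp add: exp_minus algebra_simps)
next
  case False
  then have "exp u < 1" by simp
  then have "\<bar>exp u - 1\<bar> \<le> \<bar>u\<bar> * 1" using False exp_ge_add_one_self[of u] by linarith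
  also have "\<dots> \<le> \<bar>u\<bar> * exp \<bar>u\<bar>" by (intro mult_left_mono) auto
  finally show ?thesis .
qed

text \<open>A bound free of \<theta>, as dominated convergence requires when the Cameron-Martin
  density of the shift by \<theta> times \<open>h\<close> is differentiated at 0; \<open>y\<close>
  and \<open>q\<close> stand for \<open>ip n h x\<close> and \<open>ip n h h\<close>.\<close>

lemma exp_difference_quotient_bound:
  fixes \<theta> q y :: real
  assumes "0 < \<theta>" "\<theta> \<le> 1" "0 \<le> q"
  shows "\<bar>(exp (\<theta> * y - \<theta>\<^sup>2 * q / 2) - 1) / \<theta>\<bar> \<le> exp (2 * \<bar>y\<bar> + 2 * q)"
proof -
  define u where "u = \<theta> * y - \<theta>\<^sup>2 * q / 2"
  have "\<theta>\<^sup>2 * q / 2 \<le> \<theta> * (1 * q)"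
    unfolding power2_eq_square mult.assoc using assms mult_right_mono[of \<theta> 1 q] by (simp add: mult_left_mono)
  then have u: "\<bar>u\<bar> \<le> \<theta> * (\<bar>y\<bar> + q)"
    unfolding u_def using assms abs_triangle_ineq4[of "\<theta> * y" "\<theta>\<^sup>2 * q / 2"] by (simp add: abs_mult distrib_left)
  also have "\<dots> \<le> 1 * (\<bar>y\<bar> + q)" using assms by (intro mult_right_mono) auto
  finally have u1: "\<bar>u\<bar> \<le> \<bar>y\<bar> + q" by simp
  have "\<bar>exp u - 1\<bar> \<le> (\<theta> * (\<bar>y\<bar> + q)) * exp (\<bar>y\<bar> + q)"
    using abs_exp_minus_one_le[of u] u u1 assms by (elim order_trans, intro mult_mono) auto
  also have "\<dots> \<le> (\<theta> * exp (\<bar>y\<bar> + q)) * exp (\<bar>y\<bar> + q)"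
    using assms self_le_exp by (intro mult_right_mono mult_left_mono) auto
  also have "\<dots> = \<theta> * exp (2 * \<bar>y\<bar> + 2 * q)" by (simp add: exp_add[symmetric])
  finally show ?thesis using assms by (simp add: u_def field_simps)
qed

lemma exp_difference_quotient_tendsto:
  fixes q y :: real
  shows "(\<lambda>j. (exp (inverse (real (Suc j)) * y - (inverse (real (Suc j)))\<^sup>2 * q / 2) - 1) / inverse (real (Suc j)))
    \<longlonglongrightarrow> y"
proof -
  have "((\<lambda>\<theta>. exp (\<theta> * y - \<theta>\<^sup>2 * q / 2)) has_real_derivative y) (at 0)"
    by (auto intro!: derivative_eq_intros)
  then have "((\<lambda>\<theta>. (exp (\<theta> * y - \<theta>\<^sup>2 * q / 2) - 1) / \<theta>) \<longlongrightarrow> y) (at 0)"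
    by (simp add: has_field_derivative_iff)
  moreover have "filterlim (\<lambda>j. inverse (real (Suc j))) (at 0) sequentially"
    unfolding filterlim_at using LIMSEQ_inverse_real_of_nat by simp
  ultimately show ?thesis by (rule filterlim_compose)
qed

text \<open>The second integral is the directional derivative of \<open>\<lambda>h. \<integral>x. F (x + h)\<close> at \<open>0\<close> (Gaussian
  integration by parts), obtained by differentiating the Cameron-Martin density.\<close>

lemma convex_lip_shift_ge:
  assumes F: "convex_lip n L F"
  shows "(\<integral>x. F x \<partial>gauss n) + (\<integral>x. F x * ip n h x \<partial>gauss n) \<le> (\<integral>x. F (\<lambda>i. x i + h i) \<partial>gauss n)"
proof -
  define \<theta> where "\<theta> j = inverse (real (Suc j))" for j
  have \<theta>: "0 < \<theta> j" "\<theta> j \<le> 1" for j by (auto simp: \<theta>_def field_simps)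
  define q where "q = ip n h h"
  have q: "0 \<le> q" by (simp add: q_def)
  define D where "D j x = (exp (\<theta> j * ip n h x - (\<theta> j)\<^sup>2 * q / 2) - 1) / \<theta> j" for j x
  have [measurable]: "F \<in> borel_measurable (gauss n)" by (rule convex_lip_measurable_gauss[OF F])
  have D_le: "\<bar>D j x\<bar> \<le> exp (2 * q + 2 * l1 n h * l1 n x)" for j x
  proof -
    have "\<bar>D j x\<bar> \<le> exp (2 * \<bar>ip n h x\<bar> + 2 * q)"
      unfolding D_def by (rule exp_difference_quotient_bound[OF \<theta> q])
    also have "\<dots> \<le> exp (2 * q + 2 * l1 n h * l1 n x)" using abs_ip_l1[of n h x] by simp
    finally show ?thesis .
  qed
  define w where "w x = exp ((\<bar>F (\<lambda>_. 0)\<bar> + 2 * q) + (L + 2 * l1 n h) * l1 n x)" for x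
  have w: "integrable (gauss n) w"
    unfolding w_def by (rule integrable_gaussI[where C = "\<bar>F (\<lambda>_. 0)\<bar> + 2 * q" and c = "L + 2 * l1 n h"]) auto
  have FD_le: "norm (F x * D j x) \<le> w x" for j x
  proof -
    have "\<bar>F x\<bar> * \<bar>D j x\<bar> \<le> exp (\<bar>F (\<lambda>_. 0)\<bar> + L * l1 n x) * exp (2 * q + 2 * l1 n h * l1 n x)"
      by (intro mult_mono convex_lip_growth[OF F] D_le) auto
    also have "\<dots> = w x" by (simp add: w_def exp_add[symmetric] algebra_simps)
    finally show ?thesis by (simp add: abs_mult)
  qed
  have [measurable]: "D j \<in> borel_measurable (gauss n)" for j unfolding D_def by measurable
  have lim: "(\<lambda>j. \<integral>x. F x * D j x \<partial>gauss n) \<longlonglongrightarrow> (\<integral>x. F x * ip n h x \<partial>gauss n)"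
  proof (rule integral_dominated_convergence[where w = w])
    show "AE x in gauss n. (\<lambda>j. F x * D j x) \<longlonglongrightarrow> F x * ip n h x"
      unfolding D_def \<theta>_def by (intro AE_I2 tendsto_mult_left exp_difference_quotient_tendsto)
  qed (use w FD_le in auto)
  \<comment> \<open>Since \<open>x + \<theta> h\<close> is a convex combination of \<open>x\<close>
    and \<open>x + h\<close>, every difference quotient is at most the full increment, and so is
    their limit.\<close>
  have bound: "(\<integral>x. F x * D j x \<partial>gauss n) \<le> (\<integral>x. F (\<lambda>i. x i + h i) \<partial>gauss n) - (\<integral>x. F x \<partial>gauss n)" for j
  proof -
    define E where "E x = exp (\<theta> j * ip n h x - (\<theta> j)\<^sup>2 * q / 2)" for x
    have FE: "F x * D j x = (F x * E x - F x) / \<theta> j" for x by (simp add: D_def E_def algebra_simps diff_divide_distrib)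
    have iFD: "integrable (gauss n) (\<lambda>x. F x * D j x)"
      by (rule Bochner_Integration.integrable_bound[OF w]) (use FD_le in \<open>auto simp: w_def\<close>)
    have "(\<integral>x. E x * F x \<partial>gauss n) = (\<integral>x. F (\<lambda>i\<in>{..<n}. x i + \<theta> j * h i) \<partial>gauss n)"
      by (subst gauss_shift_integral)
         (auto simp: E_def q_def ip_def sum_distrib_left power2_eq_square algebra_simps)
    also have "\<dots> = (\<integral>x. F (\<lambda>i. x i + \<theta> j * h i) \<partial>gauss n)"
      using F by (subst convex_lip_restrict) auto
    also have "\<dots> \<le> (\<integral>x. (1 - \<theta> j) * F x + \<theta> j * F (\<lambda>i. x i + h i) \<partial>gauss n)"
    proof (rule integral_mono)
      fix x
      have "(\<lambda>i. x i + \<theta> j * h i) = (\<lambda>i. (1 - \<theta> j) * x i + \<theta> j * (x i + h i))"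
        by (simp add: fun_eq_iff algebra_simps)
      then show "F (\<lambda>i. x i + \<theta> j * h i) \<le> (1 - \<theta> j) * F x + \<theta> j * F (\<lambda>i. x i + h i)"
        using convex_lipD(3)[OF F, of "\<theta> j" x "\<lambda>i. x i + h i"] \<theta>[of j] by simp
    qed (intro Bochner_Integration.integrable_add integrable_mult_right integrable_convex_lip_shift[OF F] integrable_convex_lip[OF F])+
    also have "\<dots> = (1 - \<theta> j) * (\<integral>x. F x \<partial>gauss n) + \<theta> j * (\<integral>x. F (\<lambda>i. x i + h i) \<partial>gauss n)"
      by (subst Bochner_Integration.integral_add)
         (auto intro!: integrable_mult_right integrable_convex_lip_shift[OF F] integrable_convex_lip[OF F])
    finally have le: "(\<integral>x. E x * F x \<partial>gauss n) \<le> (1 - \<theta> j) * (\<integral>x. F x \<partial>gauss n) + \<theta> j * (\<integral>x. F (\<lambda>i. x i + h i) \<partial>gauss n)" .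
    have "E x * F x = \<theta> j * (F x * D j x) + F x" for x using \<theta>[of j] by (simp add: FE mult.commute)
    then have "(\<integral>x. E x * F x \<partial>gauss n) = \<theta> j * (\<integral>x. F x * D j x \<partial>gauss n) + (\<integral>x. F x \<partial>gauss n)"
      using iFD integrable_convex_lip[OF F] by simp
    then have "\<theta> j * (\<integral>x. F x * D j x \<partial>gauss n) \<le> \<theta> j * ((\<integral>x. F (\<lambda>i. x i + h i) \<partial>gauss n) - (\<integral>x. F x \<partial>gauss n))"
      using le by (simp add: algebra_simps)
    then show ?thesis using \<theta>[of j] by simp
  qed
  show ?thesis using LIMSEQ_le_const2[OF lim] bound by fastforce
qed

text \<open>For \<open>a\<^sup>2 + b\<^sup>2 = 1\<close> this is Mehler's formula for the
  Ornstein-Uhlenbeck semigroup, with \<open>a\<close> in the role of exp (-time).\<close>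

definition smooth :: "nat \<Rightarrow> real \<Rightarrow> real \<Rightarrow> ((nat \<Rightarrow> real) \<Rightarrow> real) \<Rightarrow> (nat \<Rightarrow> real) \<Rightarrow> real" where
  "smooth n a b F x = (\<integral>y. F (\<lambda>i. a * x i + b * y i) \<partial>gauss n)"

text \<open>Gaussian integration by parts moves the derivative off \<open>F\<close>: the chain rule
  contributes \<open>a\<close>, the integration by parts \<open>1 / b\<close>. The formula makes
  sense without derivatives of \<open>F\<close> and is measurable in \<open>x\<close> by
  Fubini.\<close>

definition smooth_grad :: "nat \<Rightarrow> real \<Rightarrow> real \<Rightarrow> ((nat \<Rightarrow> real) \<Rightarrow> real) \<Rightarrow> (nat \<Rightarrow> real) \<Rightarrow> nat \<Rightarrow> real" where
  "smooth_grad n a b F x i = (a / b) * (\<integral>y. F (\<lambda>j. a * x j + b * y j) * y i \<partial>gauss n)"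

lemma integrable_convex_lip_ip:
  assumes F: "convex_lip n L F"
  shows "integrable (gauss n) (\<lambda>x. F x * ip n h x)"
proof (rule integrable_gaussI[where C = "\<bar>F (\<lambda>_. 0)\<bar>" and c = "L + l1 n h"])
  show "(\<lambda>x. F x * ip n h x) \<in> borel_measurable (gauss n)"
    using convex_lip_measurable_gauss[OF F] by measurable
  fix x
  have "\<bar>ip n h x\<bar> \<le> exp (l1 n h * l1 n x)" using abs_ip_l1[of n h x] self_le_exp order_trans by blast
  then have "\<bar>F x\<bar> * \<bar>ip n h x\<bar> \<le> exp (\<bar>F (\<lambda>_. 0)\<bar> + L * l1 n x) * exp (l1 n h * l1 n x)"
    by (intro mult_mono convex_lip_growth[OF F]) auto
  then show "\<bar>F x * ip n h x\<bar> \<le> exp (\<bar>F (\<lambda>_. 0)\<bar> + (L + l1 n h) * l1 n x)"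
    by (simp add: abs_mult exp_add[symmetric] algebra_simps)
qed

lemma integrable_convex_lip_component:
  assumes F: "convex_lip n L F" and "i < n"
  shows "integrable (gauss n) (\<lambda>x. F x * x i)"
proof -
  have "ip n (\<lambda>j. if j = i then 1 else 0) x = x i" for x
    using \<open>i < n\<close> by (simp add: ip_def if_distrib[where f = "\<lambda>t. t * _"] sum.delta cong: if_cong)
  then show ?thesis using integrable_convex_lip_ip[OF F, of "\<lambda>j. if j = i then 1 else 0"] by simp
qed

text \<open>Moving \<open>x\<close> to \<open>y\<close> amounts to translating the noise by
  \<open>(a / b) * (y - x)\<close>, so \<open>convex_lip_shift_ge\<close> applies to the function of
  the noise with \<open>x\<close> held fixed.\<close>

lemma smooth_subgradient:
  assumes F: "convex_lip n L F" and ab: "a > 0" "b > 0"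
  shows "smooth n a b F x + ip n (smooth_grad n a b F x) (\<lambda>i. y i - x i) \<le> smooth n a b F y"
proof -
  define F' where "F' z = F (\<lambda>i. a * x i + b * z i)" for z
  have F': "convex_lip n (L * \<bar>b\<bar>) F'" unfolding F'_def by (rule convex_lip_affine[OF F])
  define h where "h i = (a / b) * (y i - x i)" for i
  have "(\<integral>z. F' z * ip n h z \<partial>gauss n) = (\<integral>z. (\<Sum>i<n. h i * (F' z * z i)) \<partial>gauss n)"
    by (intro Bochner_Integration.integral_cong refl) (simp add: ip_def sum_distrib_left mult_ac)
  also have "\<dots> = (\<Sum>i<n. h i * (\<integral>z. F' z * z i \<partial>gauss n))"
    by (subst Bochner_Integration.integral_sum) (auto intro!: integrable_mult_right integrable_convex_lip_component[OF F'])
  also have "\<dots> = ip n (smooth_grad n a b F x) (\<lambda>i. y i - x i)"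
    by (simp add: ip_def smooth_grad_def F'_def h_def mult_ac)
  finally have "(\<integral>z. F' z * ip n h z \<partial>gauss n) = ip n (smooth_grad n a b F x) (\<lambda>i. y i - x i)" .
  moreover have "F' (\<lambda>i. z i + h i) = F (\<lambda>i. a * y i + b * z i)" for z
    using ab by (simp add: F'_def h_def algebra_simps)
  ultimately show ?thesis
    using convex_lip_shift_ge[OF F', of h] by (simp add: smooth_def F'_def)
qed

lemma convex_lip_smooth:
  assumes F: "convex_lip n L F" and a: "0 \<le> a" "a \<le> 1"
  shows "convex_lip n L (smooth n a b F)"
  unfolding convex_lip_def
proof (intro conjI allI ballI)
  interpret g: prob_space "gauss n" by (rule prob_space_gauss)
  show L: "0 \<le> L" by (rule convex_lipD(1)[OF F])
  have int: "integrable (gauss n) (\<lambda>z. F (\<lambda>i. a * x i + b * z i))" for x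
    by (rule integrable_convex_lip[OF convex_lip_affine[OF F]])
  fix x y :: "nat \<Rightarrow> real"
  have "\<bar>smooth n a b F x - smooth n a b F y\<bar> = \<bar>\<integral>z. F (\<lambda>i. a * x i + b * z i) - F (\<lambda>i. a * y i + b * z i) \<partial>gauss n\<bar>"
    unfolding smooth_def by (subst Bochner_Integration.integral_diff) (auto intro: int)
  also have "\<dots> \<le> (\<integral>z. \<bar>F (\<lambda>i. a * x i + b * z i) - F (\<lambda>i. a * y i + b * z i)\<bar> \<partial>gauss n)"
    by (rule integral_abs_bound)
  also have "\<dots> \<le> (\<integral>z. L * L2_set (\<lambda>i. x i - y i) {..<n} \<partial>gauss n)"
  proof (rule integral_mono)
    fix z
    have "L2_set (\<lambda>i. (a * x i + b * z i) - (a * y i + b * z i)) {..<n} = \<bar>a\<bar> * L2_set (\<lambda>i. x i - y i) {..<n}"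
      by (simp add: L2_set_def right_diff_distrib[symmetric] power_mult_distrib sum_distrib_left[symmetric] real_sqrt_mult)
    also have "\<dots> \<le> L2_set (\<lambda>i. x i - y i) {..<n}"
      using a by (simp add: mult_left_le_one_le)
    finally show "\<bar>F (\<lambda>i. a * x i + b * z i) - F (\<lambda>i. a * y i + b * z i)\<bar> \<le> L * L2_set (\<lambda>i. x i - y i) {..<n}"
      using convex_lipD(2)[OF F, of "\<lambda>i. a * x i + b * z i" "\<lambda>i. a * y i + b * z i"] L
      by (meson mult_left_mono order_trans)
  qed (auto intro!: integrable_abs Bochner_Integration.integrable_diff int)
  finally show "\<bar>smooth n a b F x - smooth n a b F y\<bar> \<le> L * L2_set (\<lambda>i. x i - y i) {..<n}"
    by (simp add: g.prob_space)
  fix u :: real assume u: "u \<in> {0..1}"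
  have "smooth n a b F (\<lambda>i. (1 - u) * x i + u * y i)
      \<le> (\<integral>z. (1 - u) * F (\<lambda>i. a * x i + b * z i) + u * F (\<lambda>i. a * y i + b * z i) \<partial>gauss n)"
    unfolding smooth_def
  proof (rule integral_mono)
    fix z
    have "(\<lambda>i. a * ((1 - u) * x i + u * y i) + b * z i) = (\<lambda>i. (1 - u) * (a * x i + b * z i) + u * (a * y i + b * z i))"
      by (simp add: fun_eq_iff algebra_simps)
    then show "F (\<lambda>i. a * ((1 - u) * x i + u * y i) + b * z i) \<le> (1 - u) * F (\<lambda>i. a * x i + b * z i) + u * F (\<lambda>i. a * y i + b * z i)"
      using convex_lipD(3)[OF F, of u "\<lambda>i. a * x i + b * z i" "\<lambda>i. a * y i + b * z i"] u by simp
  qed (auto intro!: Bochner_Integration.integrable_add integrable_mult_right int)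
  also have "\<dots> = (1 - u) * smooth n a b F x + u * smooth n a b F y"
    unfolding smooth_def by (subst Bochner_Integration.integral_add) (auto intro!: integrable_mult_right int)
  finally show "smooth n a b F (\<lambda>i. (1 - u) * x i + u * y i) \<le> (1 - u) * smooth n a b F x + u * smooth n a b F y" .
qed

lemma measurable_smooth_grad:
  assumes F: "convex_lip n L F" and "i < n"
  shows "(\<lambda>x. smooth_grad n a b F x i) \<in> borel_measurable (gauss n)"
proof -
  interpret g: prob_space "gauss n" by (rule prob_space_gauss)
  have [measurable]: "(\<lambda>w. F (\<lambda>j. a * fst w j + b * snd w j)) \<in> borel_measurable (gauss n \<Otimes>\<^sub>M gauss n)"
    by (rule convex_lip_measurable[OF F]) measurable
  show ?thesis
    unfolding smooth_grad_def using \<open>i < n\<close>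
    by (intro borel_measurable_times borel_measurable_const g.borel_measurable_lebesgue_integral)
       (simp add: case_prod_beta)
qed

text \<open>Testing the subgradient inequality at \<open>x + \<xi>\<close> gives a squared length of
  at most \<open>L\<close> times the length.\<close>

lemma subgradient_norm_le:
  assumes g: "convex_lip n L g" and sub: "\<And>y. g x + ip n \<xi> (\<lambda>i. y i - x i) \<le> g y"
  shows "L2_set \<xi> {..<n} \<le> L"
proof -
  have "ip n \<xi> \<xi> \<le> g (\<lambda>i. x i + \<xi> i) - g x" using sub[of "\<lambda>i. x i + \<xi> i"] by simp
  also have "\<dots> \<le> L * L2_set \<xi> {..<n}" using convex_lipD(2)[OF g, of "\<lambda>i. x i + \<xi> i" x] by simp
  finally have "L2_set \<xi> {..<n} * L2_set \<xi> {..<n} \<le> L * L2_set \<xi> {..<n}"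
    by (simp add: ip_self_L2_set power2_eq_square)
  then show ?thesis
    using convex_lipD(1)[OF g] L2_set_nonneg[of \<xi> "{..<n}"] by (cases "L2_set \<xi> {..<n} = 0") auto
qed

section \<open>Iterated rotations and the variance\<close>

lemma square_ip_le: "(ip n x y)\<^sup>2 \<le> ip n x x * ip n y y"
  using power_mono[OF abs_ip_le[of n x y], of 2] by (simp add: ip_self_L2_set power_mult_distrib)

lemma square_sum_le: "((p::real) + q)\<^sup>2 \<le> 2 * p\<^sup>2 + 2 * q\<^sup>2"
  using zero_le_power2[of "p - q"] by (simp add: power2_eq_square algebra_simps)

lemma integrable_gauss_pair_fst:
  assumes "integrable (gauss n) f"
  shows "integrable (gauss n \<Otimes>\<^sub>M gauss n) (\<lambda>p. f (fst p))"
    "(\<integral>p. f (fst p) \<partial>(gauss n \<Otimes>\<^sub>M gauss n)) = (\<integral>x. f x \<partial>gauss n :: real)"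
proof -
  interpret g: prob_space "gauss n" by (rule prob_space_gauss)
  have d: "distr (gauss n \<Otimes>\<^sub>M gauss n) (gauss n) fst = gauss n"
    by (rule g.distr_pair_fst) 
  have f: "f \<in> borel_measurable (gauss n)" using assms by simp
  show "integrable (gauss n \<Otimes>\<^sub>M gauss n) (\<lambda>p. f (fst p))"
    using integrable_distr[of fst "gauss n \<Otimes>\<^sub>M gauss n" "gauss n" f] assms by (simp add: d)
  show "(\<integral>p. f (fst p) \<partial>(gauss n \<Otimes>\<^sub>M gauss n)) = (\<integral>x. f x \<partial>gauss n)"
    using integral_distr[of fst "gauss n \<Otimes>\<^sub>M gauss n" "gauss n" f] f by (simp add: d)
qed

lemma integrable_gauss_pair_snd:
  assumes "integrable (gauss n) f"
  shows "integrable (gauss n \<Otimes>\<^sub>M gauss n) (\<lambda>p. f (snd p))"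
    "(\<integral>p. f (snd p) \<partial>(gauss n \<Otimes>\<^sub>M gauss n)) = (\<integral>x. f x \<partial>gauss n :: real)"
proof -
  interpret g: prob_space "gauss n" by (rule prob_space_gauss)
  interpret gg: pair_prob_space "gauss n" "gauss n" ..
  have f: "f \<in> borel_measurable (gauss n)" using assms by simp
  have s: "(\<lambda>p. f (snd p)) = (\<lambda>(x, y). f (fst (y, x)))" by auto
  show "integrable (gauss n \<Otimes>\<^sub>M gauss n) (\<lambda>p. f (snd p))"
    unfolding s by (rule gg.integrable_product_swap[OF integrable_gauss_pair_fst(1)[OF assms]])
  show "(\<integral>p. f (snd p) \<partial>(gauss n \<Otimes>\<^sub>M gauss n)) = (\<integral>x. f x \<partial>gauss n)"
    unfolding s using f by (subst gg.integral_product_swap) (auto simp: integrable_gauss_pair_fst(2)[OF assms])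
qed

lemma rot_iterate:
  assumes "a\<^sup>2 + b\<^sup>2 = 1" "a > 0" and f: "f \<in> borel_measurable (gauss n \<Otimes>\<^sub>M gauss n)"
  shows "(rot n a b ^^ k) \<in> gauss n \<Otimes>\<^sub>M gauss n \<rightarrow>\<^sub>M gauss n \<Otimes>\<^sub>M gauss n"
    "integrable (gauss n \<Otimes>\<^sub>M gauss n) f \<Longrightarrow> integrable (gauss n \<Otimes>\<^sub>M gauss n) (\<lambda>p. f ((rot n a b ^^ k) p))"
    "(\<integral>p. f ((rot n a b ^^ k) p) \<partial>(gauss n \<Otimes>\<^sub>M gauss n)) = (\<integral>p. f p \<partial>(gauss n \<Otimes>\<^sub>M gauss n) :: real)"
proof -
  let ?N = "gauss n \<Otimes>\<^sub>M gauss n" and ?R = "rot n a b"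
  have *: "(?R ^^ k) \<in> ?N \<rightarrow>\<^sub>M ?N \<and> distr ?N ?N (?R ^^ k) = ?N"
  proof (induction k)
    case 0
    have "distr ?N ?N (\<lambda>x. x) = ?N" by (rule distr_id)
    then show ?case by (simp add: id_def)
  next
    case (Suc k)
    then have m: "(?R ^^ k) \<in> ?N \<rightarrow>\<^sub>M ?N" by blast
    have m': "(?R ^^ Suc k) \<in> ?N \<rightarrow>\<^sub>M ?N" 
      unfolding funpow.simps by (rule measurable_comp[OF m measurable_rot])
    have "distr ?N ?N (?R ^^ Suc k) = distr (distr ?N ?N (?R ^^ k)) ?N ?R"
      unfolding funpow.simps by (rule distr_distr[OF measurable_rot m, symmetric])
    also have "\<dots> = ?N" by (simp only: conjunct2[OF Suc] distr_gauss_pair_rotate[OF assms(1,2)])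
    finally show ?case using m' by blast
  qed
  show 1: "(?R ^^ k) \<in> ?N \<rightarrow>\<^sub>M ?N" using * by blast
  show "integrable ?N (\<lambda>p. f ((?R ^^ k) p))" if "integrable ?N f"
    using integrable_distr[OF 1, of f] that conjunct2[OF *] by (simp only:)
  show "(\<integral>p. f ((?R ^^ k) p) \<partial>?N) = (\<integral>p. f p \<partial>?N)"
    using integral_distr[OF 1 f] conjunct2[OF *] by (simp only:)
qed

text \<open>Stated coordinatewise because at \<open>k = 0\<close> the iterate is \<open>p\<close>
  itself, which need not be extensional.\<close>

lemma rot_iterate_coords:
  assumes "i < n"
  shows "fst ((rot n (cos \<delta>) (sin \<delta>) ^^ k) p) i = cos (real k * \<delta>) * fst p i + sin (real k * \<delta>) * snd p i \<and>
    snd ((rot n (cos \<delta>) (sin \<delta>) ^^ k) p) i = cos (real k * \<delta>) * snd p i - sin (real k * \<delta>) * fst p i"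
proof (induction k)
  case (Suc k)
  have "real (Suc k) * \<delta> = real k * \<delta> + \<delta>" by (simp add: algebra_simps)
  then show ?case using Suc assms
    by (simp only: funpow.simps comp_apply rot_def fst_conv snd_conv restrict_apply' lessThan_iff cos_add sin_add)
       (simp add: algebra_simps)
qed simp

definition gauss_var :: "nat \<Rightarrow> ((nat \<Rightarrow> real) \<Rightarrow> real) \<Rightarrow> real" where
  "gauss_var n F = (\<integral>x. (F x)\<^sup>2 \<partial>gauss n) - (\<integral>x. F x \<partial>gauss n)\<^sup>2"

lemma integrable_convex_lip_square:
  assumes F: "convex_lip n L F"
  shows "integrable (gauss n) (\<lambda>x. (F x)\<^sup>2)"
proof (rule integrable_gaussI[where C = "2 * \<bar>F (\<lambda>_. 0)\<bar>" and c = "2 * L"])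
  show "(\<lambda>x. (F x)\<^sup>2) \<in> borel_measurable (gauss n)"
    using convex_lip_measurable_gauss[OF F] by measurable
  fix x
  have "\<bar>F x\<bar>\<^sup>2 \<le> (exp (\<bar>F (\<lambda>_. 0)\<bar> + L * l1 n x))\<^sup>2"
    by (intro power_mono convex_lip_growth[OF F]) auto
  then show "\<bar>(F x)\<^sup>2\<bar> \<le> exp (2 * \<bar>F (\<lambda>_. 0)\<bar> + 2 * L * l1 n x)"
    by (simp add: power2_eq_square exp_add[symmetric] algebra_simps)
qed

lemma second_moment_about:
  assumes F: "convex_lip n L F"
  shows "(\<integral>x. (F x - c)\<^sup>2 \<partial>gauss n) = gauss_var n F + ((\<integral>x. F x \<partial>gauss n) - c)\<^sup>2"
    and "integrable (gauss n) (\<lambda>x. (F x - c)\<^sup>2)"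
proof -
  interpret g: prob_space "gauss n" by (rule prob_space_gauss)
  have eq: "(F x - c)\<^sup>2 = (F x)\<^sup>2 - 2 * c * F x + c\<^sup>2" for x by (simp add: power2_eq_square algebra_simps)
  show "integrable (gauss n) (\<lambda>x. (F x - c)\<^sup>2)"
    unfolding eq using integrable_convex_lip_square[OF F] integrable_convex_lip[OF F] by simp
  show "(\<integral>x. (F x - c)\<^sup>2 \<partial>gauss n) = gauss_var n F + ((\<integral>x. F x \<partial>gauss n) - c)\<^sup>2"
    unfolding eq gauss_var_def using integrable_convex_lip_square[OF F] integrable_convex_lip[OF F]
    by (simp add: g.prob_space) (simp add: power2_eq_square algebra_simps)
qed

text \<open>Twice the variance is the mean squared difference of two independent copies. In this
  form it is an increment of \<open>F\<close>, which can be cut along a path of rotations from one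
  copy to the other.\<close>

lemma gauss_var_pair:
  assumes F: "convex_lip n L F"
  shows "(\<integral>p. (F (snd p) - F (fst p))\<^sup>2 \<partial>(gauss n \<Otimes>\<^sub>M gauss n)) = 2 * gauss_var n F"
proof -
  interpret g: prob_space "gauss n" by (rule prob_space_gauss)
  interpret gg: pair_prob_space "gauss n" "gauss n" ..
  let ?N = "gauss n \<Otimes>\<^sub>M gauss n"
  note i1 = integrable_convex_lip[OF F] and i2 = integrable_convex_lip_square[OF F]
  have m[measurable]: "F \<in> borel_measurable (gauss n)" by (rule convex_lip_measurable_gauss[OF F])
  have "\<bar>F (fst p) * F (snd p)\<bar> \<le> (F (fst p))\<^sup>2 + (F (snd p))\<^sup>2" for p
  proof -
    have "2 * \<bar>F (fst p)\<bar> * \<bar>F (snd p)\<bar> \<le> (F (fst p))\<^sup>2 + (F (snd p))\<^sup>2"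
      using sum_squares_bound[of "\<bar>F (fst p)\<bar>" "\<bar>F (snd p)\<bar>"] by simp
    moreover have "0 \<le> \<bar>F (fst p)\<bar> * \<bar>F (snd p)\<bar>" by simp
    ultimately show ?thesis unfolding abs_mult by linarith
  qed
  then have p: "integrable ?N (\<lambda>p. F (fst p) * F (snd p))"
    by (intro Bochner_Integration.integrable_bound[OF Bochner_Integration.integrable_add[OF
          integrable_gauss_pair_fst(1)[OF i2] integrable_gauss_pair_snd(1)[OF i2]]]) auto
  have q: "(\<integral>p. F (fst p) * F (snd p) \<partial>?N) = (\<integral>x. F x \<partial>gauss n)\<^sup>2"
    by (subst gg.integral_fst'[OF p, symmetric]) (simp add: power2_eq_square)
  have eq: "(F (snd p) - F (fst p))\<^sup>2 = (F (snd p))\<^sup>2 + (F (fst p))\<^sup>2 - 2 * (F (fst p) * F (snd p))" for p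
    by (simp add: power2_eq_square algebra_simps)
  show ?thesis unfolding eq
    using p q integrable_gauss_pair_fst[OF i2] integrable_gauss_pair_snd[OF i2] by (simp add: gauss_var_def)
qed

section \<open>Poincare inequality\<close>

lemma square_le_of_sandwich:
  fixes d l u :: real
  assumes "l \<le> d" "d \<le> u"
  shows "d\<^sup>2 \<le> l\<^sup>2 + u\<^sup>2"
proof (cases "d \<ge> 0")
  case True
  then have "d\<^sup>2 \<le> u\<^sup>2" using assms by (intro power_mono) auto
  then show ?thesis by (simp add: add_increasing)
next
  case False
  then have "(-d)\<^sup>2 \<le> (-l)\<^sup>2" using assms by (intro power_mono) auto
  then show ?thesis by (simp add: add_increasing2)
qed

text \<open>A measurable choice of subgradients takes the place of the gradient in the Poincare
  inequality.\<close>

locale subgradient_field =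
  fixes n :: nat and L :: real and g :: "(nat \<Rightarrow> real) \<Rightarrow> real" and \<xi> :: "(nat \<Rightarrow> real) \<Rightarrow> nat \<Rightarrow> real"
  assumes lip: "convex_lip n L g"
    and sub: "g x + ip n (\<xi> x) (\<lambda>i. y i - x i) \<le> g y"
    and meas: "i < n \<Longrightarrow> (\<lambda>x. \<xi> x i) \<in> borel_measurable (gauss n)"
begin

lemma norm_le: "L2_set (\<xi> x) {..<n} \<le> L"
  by (rule subgradient_norm_le[OF lip sub])

lemma ip_le: "ip n (\<xi> x) (\<xi> x) \<le> L\<^sup>2"
  unfolding ip_self_L2_set by (intro power_mono norm_le) simp

lemma meas_pair [measurable]:
  "i < n \<Longrightarrow> (\<lambda>p. \<xi> (fst p) i) \<in> borel_measurable (gauss n \<Otimes>\<^sub>M gauss n)"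
  by (rule measurable_compose[OF measurable_fst meas])

lemma integrable_ip: "integrable (gauss n) (\<lambda>x. ip n (\<xi> x) (\<xi> x))"
proof (rule integrable_gaussI[where C = "L\<^sup>2" and c = 0])
  show "(\<lambda>x. ip n (\<xi> x) (\<xi> x)) \<in> borel_measurable (gauss n)"
    by (rule measurable_ip) (auto intro: meas)
  fix x
  show "\<bar>ip n (\<xi> x) (\<xi> x)\<bar> \<le> exp (L\<^sup>2 + 0 * l1 n x)"
    using ip_le[of x] self_le_exp[of "L\<^sup>2"] by simp
qed

lemma integrable_pair: "integrable (gauss n \<Otimes>\<^sub>M gauss n) (\<lambda>p. (ip n (\<xi> (fst p)) (snd p))\<^sup>2)"
proof (rule Bochner_Integration.integrable_bound)
  show "integrable (gauss n \<Otimes>\<^sub>M gauss n) (\<lambda>p. L\<^sup>2 * ip n (snd p) (snd p))"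
    by (intro integrable_mult_right integrable_gauss_pair_snd(1)[OF integrable_ip_self])
  have "(\<lambda>p. ip n (\<xi> (fst p)) (snd p)) \<in> borel_measurable (gauss n \<Otimes>\<^sub>M gauss n)"
    by (rule measurable_ip) measurable
  then show "(\<lambda>p. (ip n (\<xi> (fst p)) (snd p))\<^sup>2) \<in> borel_measurable (gauss n \<Otimes>\<^sub>M gauss n)" by measurable
  have "(ip n (\<xi> (fst p)) (snd p))\<^sup>2 \<le> L\<^sup>2 * ip n (snd p) (snd p)" for p
    by (rule order_trans[OF square_ip_le mult_right_mono[OF ip_le]]) simp
  then show "AE p in gauss n \<Otimes>\<^sub>M gauss n. norm ((ip n (\<xi> (fst p)) (snd p))\<^sup>2) \<le> norm (L\<^sup>2 * ip n (snd p) (snd p))"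
    by (auto intro!: AE_I2 order_trans[OF _ abs_ge_self])
qed

text \<open>With the first point fixed, the inner product is a linear form in an independent
  Gaussian vector, whose second moment involves only the length of \<xi>. Cauchy-Schwarz, good
  enough for integrability, would cost a factor of order \<open>n\<close> here.\<close>

lemma integral_pair_le:
  "(\<integral>p. (ip n (\<xi> (fst p)) (snd p))\<^sup>2 \<partial>(gauss n \<Otimes>\<^sub>M gauss n)) \<le> 8 * (\<integral>x. ip n (\<xi> x) (\<xi> x) \<partial>gauss n)"
proof -
  interpret g: prob_space "gauss n" by (rule prob_space_gauss)
  interpret gg: pair_prob_space "gauss n" "gauss n" ..
  have "(\<integral>p. (ip n (\<xi> (fst p)) (snd p))\<^sup>2 \<partial>(gauss n \<Otimes>\<^sub>M gauss n)) = (\<integral>x. \<integral>y. (ip n (\<xi> x) y)\<^sup>2 \<partial>gauss n \<partial>gauss n)"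
    by (subst gg.integral_fst'[OF integrable_pair, symmetric]) simp
  also have "\<dots> \<le> (\<integral>x. 8 * ip n (\<xi> x) (\<xi> x) \<partial>gauss n)"
    using gg.integrable_fst'[OF integrable_pair]
    by (intro integral_mono integral_ip_square_le integrable_mult_right integrable_ip) simp
  finally show ?thesis by simp
qed

text \<open>Convexity sandwiches the increment between the values of the subgradients at its two endpoints,
  and by rotation invariance both values have the same kind of second moment.\<close>

lemma poincare_step:
  assumes cs: "c\<^sup>2 + s\<^sup>2 = 1" "c > 0"
  shows "integrable (gauss n \<Otimes>\<^sub>M gauss n) (\<lambda>p. (g (fst (rot n c s p)) - g (fst p))\<^sup>2)"
    and "(\<integral>p. (g (fst (rot n c s p)) - g (fst p))\<^sup>2 \<partial>(gauss n \<Otimes>\<^sub>M gauss n))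
      \<le> 32 * (1 - c)\<^sup>2 * L\<^sup>2 * n + 32 * s\<^sup>2 * (\<integral>x. ip n (\<xi> x) (\<xi> x) \<partial>gauss n)" (is "?I \<le> _")
proof -
  let ?N = "gauss n \<Otimes>\<^sub>M gauss n"
  \<comment> \<open>\<open>B\<close> bounds the square of the linearised increment. The radial term
    carries \<open>1 - c\<close>, of second order in the angle, and can afford the crude bound by
    \<open>L\<close>; the tangential term is of first order and has to keep \<xi> itself.\<close>
  define B where "B p = 2 * (1 - c)\<^sup>2 * L\<^sup>2 * ip n (fst p) (fst p) + 2 * s\<^sup>2 * (ip n (\<xi> (fst p)) (snd p))\<^sup>2" for p
  have iB: "integrable ?N B"
    unfolding B_def by (intro Bochner_Integration.integrable_add integrable_mult_right integrable_pair
        integrable_gauss_pair_fst(1)[OF integrable_ip_self])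
  have "(\<integral>p. B p \<partial>?N) = 2 * (1 - c)\<^sup>2 * L\<^sup>2 * (\<integral>x. ip n x x \<partial>gauss n) + 2 * s\<^sup>2 * (\<integral>p. (ip n (\<xi> (fst p)) (snd p))\<^sup>2 \<partial>?N)"
    unfolding B_def
    by (subst Bochner_Integration.integral_add)
       (auto intro!: integrable_mult_right integrable_pair integrable_gauss_pair_fst(1)[OF integrable_ip_self]
             simp: integrable_gauss_pair_fst(2)[OF integrable_ip_self])
  also have "\<dots> \<le> 2 * (1 - c)\<^sup>2 * L\<^sup>2 * (8 * n) + 2 * s\<^sup>2 * (8 * (\<integral>x. ip n (\<xi> x) (\<xi> x) \<partial>gauss n))"
    by (intro add_mono mult_left_mono integral_ip_self_le integral_pair_le) auto
  finally have B: "(\<integral>p. B p \<partial>?N) \<le> 16 * (1 - c)\<^sup>2 * L\<^sup>2 * n + 16 * s\<^sup>2 * (\<integral>x. ip n (\<xi> x) (\<xi> x) \<partial>gauss n)" by simp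
  have B_bound: "(k * ip n (\<xi> x) x + s * ip n (\<xi> x) y)\<^sup>2 \<le> B (x, y)" if "k\<^sup>2 = (1 - c)\<^sup>2" for k x y
  proof -
    have "(k * ip n (\<xi> x) x + s * ip n (\<xi> x) y)\<^sup>2 \<le> 2 * (k * ip n (\<xi> x) x)\<^sup>2 + 2 * (s * ip n (\<xi> x) y)\<^sup>2"
      by (rule square_sum_le)
    also have "\<dots> = 2 * (1 - c)\<^sup>2 * (ip n (\<xi> x) x)\<^sup>2 + 2 * s\<^sup>2 * (ip n (\<xi> x) y)\<^sup>2"
      using that by (simp add: power_mult_distrib)
    also have "2 * (1 - c)\<^sup>2 * (ip n (\<xi> x) x)\<^sup>2 \<le> 2 * (1 - c)\<^sup>2 * (L\<^sup>2 * ip n x x)"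
      by (intro mult_left_mono order_trans[OF square_ip_le mult_right_mono[OF ip_le]]) auto
    finally show ?thesis by (simp add: B_def mult_ac)
  qed
  define D where "D p = g (fst (rot n c s p)) - g (fst p)" for p
  have D_le: "(D (x, y))\<^sup>2 \<le> B (x, y) + B (rot n c s (x, y))" for x y
  proof -
    define W W' where "W = fst (rot n c s (x, y))" and "W' = snd (rot n c s (x, y))"
    have W: "W i = c * x i + s * y i" "W' i = c * y i - s * x i" if "i < n" for i
      using that by (simp_all add: W_def W'_def rot_def)
    have "ip n (\<xi> x) (\<lambda>i. W i - x i) = ip n (\<xi> x) (\<lambda>i. (c - 1) * x i + s * y i)"
      unfolding ip_def by (intro sum.cong refl) (simp add: W algebra_simps)
    then have 1: "(c - 1) * ip n (\<xi> x) x + s * ip n (\<xi> x) y \<le> D (x, y)"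
      using sub[of x W] by (simp add: D_def W_def ip_add_right ip_scale_right)
    \<comment> \<open>The upper bound uses the subgradient at the far end \<open>W\<close>. In the
      rotated frame \<open>(W, W')\<close> the way back is a rotation by the opposite angle, so this
      bound is \<open>B\<close> at the rotated point and has the same integral.\<close>
    have "ip n (\<xi> W) (\<lambda>i. x i - W i) = ip n (\<xi> W) (\<lambda>i. (c - 1) * W i + (- s) * W' i)"
      unfolding ip_def
    proof (intro sum.cong refl)
      fix i assume i: "i \<in> {..<n}"
      have "c * W i - s * W' i = (c\<^sup>2 + s\<^sup>2) * x i"
        using i by (simp add: W power2_eq_square algebra_simps)
      then have "x i - W i = (c - 1) * W i + (- s) * W' i" using cs by (simp add: algebra_simps)
      then show "\<xi> W i * (x i - W i) = \<xi> W i * ((c - 1) * W i + (- s) * W' i)"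
        by (simp only:)
    qed
    also have "\<dots> = (c - 1) * ip n (\<xi> W) W + (- s) * ip n (\<xi> W) W'"
      by (simp only: ip_add_right ip_scale_right)
    finally have 2: "D (x, y) \<le> (1 - c) * ip n (\<xi> W) W + s * ip n (\<xi> W) W'"
      using sub[of W x] unfolding D_def W_def[symmetric] by (simp add: algebra_simps)
    have "(D (x, y))\<^sup>2 \<le> B (x, y) + B (W, W')"
      by (rule order_trans[OF square_le_of_sandwich[OF 1 2] add_mono[OF B_bound B_bound]])
         (simp_all add: power2_commute)
    moreover have "(W, W') = rot n c s (x, y)" by (simp add: W_def W'_def)
    ultimately show ?thesis by simp
  qed
  note ri = rot_iterate[OF cs, where k = 1, simplified funpow.simps One_nat_def comp_id]
  have iBR: "integrable ?N (\<lambda>p. B (rot n c s p))" and BR: "(\<integral>p. B (rot n c s p) \<partial>?N) = (\<integral>p. B p \<partial>?N)"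
    by (rule ri(2)[OF _ iB] ri(3); use iB in simp)+
  have mg: "g \<in> borel_measurable (gauss n)" by (rule convex_lip_measurable_gauss[OF lip])
  have [measurable]: "D \<in> borel_measurable ?N"
    unfolding D_def
    by (intro borel_measurable_diff measurable_compose[OF measurable_fst mg]
          measurable_compose[OF measurable_rot measurable_compose[OF measurable_fst mg]])
  have iS: "integrable ?N (\<lambda>p. B p + B (rot n c s p))"
    by (rule Bochner_Integration.integrable_add[OF iB iBR])
  have iD: "integrable ?N (\<lambda>p. (D p)\<^sup>2)"
    by (rule Bochner_Integration.integrable_bound[OF iS])
       (use D_le in \<open>auto intro!: AE_I2 order_trans[OF _ abs_ge_self]\<close>)
  then show "integrable ?N (\<lambda>p. (g (fst (rot n c s p)) - g (fst p))\<^sup>2)"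
    by (simp only: D_def)
  have "(\<integral>p. (D p)\<^sup>2 \<partial>?N) \<le> (\<integral>p. B p + B (rot n c s p) \<partial>?N)"
    by (rule integral_mono[OF iD iS]) (use D_le in \<open>metis prod.collapse\<close>)
  also have "\<dots> = 2 * (\<integral>p. B p \<partial>?N)" using BR by (simp only: Bochner_Integration.integral_add[OF iB iBR])
  also have "\<dots> \<le> 32 * (1 - c)\<^sup>2 * L\<^sup>2 * n + 32 * s\<^sup>2 * (\<integral>x. ip n (\<xi> x) (\<xi> x) \<partial>gauss n)" using B by simp
  finally show "?I \<le> 32 * (1 - c)\<^sup>2 * L\<^sup>2 * n + 32 * s\<^sup>2 * (\<integral>x. ip n (\<xi> x) (\<xi> x) \<partial>gauss n)"
    by (simp only: D_def)
qed

text \<open>Cauchy-Schwarz on the \<open>N\<close> telescoping terms costs a factor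
  \<open>N\<close>, and invariance makes their second moments equal, so the estimate for one step is
  multiplied by \<open>(real N)\<^sup>2\<close>. With an angle of order \<open>1 / N\<close> the
  energy term stays bounded, while the term with the dimension decays like
  \<open>1 / (real N)\<^sup>2\<close>. \<open>N \<ge> 2\<close> keeps the angle below a right angle,
  so that \<open>c > 0\<close>.\<close>

lemma poincare_rotations:
  assumes N: "2 \<le> N"
  shows "gauss_var n g \<le> 64 * (\<integral>x. ip n (\<xi> x) (\<xi> x) \<partial>gauss n) + 64 * L\<^sup>2 * n / (real N)\<^sup>2"
proof -
  let ?N = "gauss n \<Otimes>\<^sub>M gauss n" and ?E = "\<integral>x. ip n (\<xi> x) (\<xi> x) \<partial>gauss n"
  define \<delta> where "\<delta> = pi / (2 * real N)"
  have \<delta>: "0 < \<delta>" "\<delta> < pi / 2" "real N * \<delta> = pi / 2"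
    using N by (auto simp: \<delta>_def field_simps)
  define c s where "c = cos \<delta>" and "s = sin \<delta>"
  have c: "c > 0" unfolding c_def using \<delta> by (intro cos_gt_zero) auto
  have cs: "c\<^sup>2 + s\<^sup>2 = 1" by (simp add: c_def s_def)
  define R where "R = rot n c s"
  define D where "D p = g (fst (R p)) - g (fst p)" for p
  have mD[measurable]: "D \<in> borel_measurable ?N"
  proof -
    have mg: "g \<in> borel_measurable (gauss n)" by (rule convex_lip_measurable_gauss[OF lip])
    show ?thesis
      unfolding D_def R_def
      by (intro borel_measurable_diff measurable_compose[OF measurable_fst mg]
          measurable_compose[OF measurable_rot measurable_compose[OF measurable_fst mg]])
  qed
  have mD2: "(\<lambda>p. (D p)\<^sup>2) \<in> borel_measurable ?N" by measurable
  have iD: "integrable ?N (\<lambda>p. (D p)\<^sup>2)" and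
    ED: "(\<integral>p. (D p)\<^sup>2 \<partial>?N) \<le> 32 * (1 - c)\<^sup>2 * L\<^sup>2 * n + 32 * s\<^sup>2 * ?E"
    using poincare_step[OF cs c] unfolding D_def R_def by blast+
  note ri = rot_iterate[OF cs c mD2, folded R_def]
  have tele: "g (snd p) - g (fst p) = (\<Sum>k<N. D ((R ^^ k) p))" for p
  proof -
    have "(\<Sum>k<N. D ((R ^^ k) p)) = (\<Sum>k<N. g (fst ((R ^^ Suc k) p)) - g (fst ((R ^^ k) p)))"
      by (simp add: D_def)
    also have "\<dots> = g (fst ((R ^^ N) p)) - g (fst p)"
      by (subst sum_lessThan_telescope) simp
    \<comment> \<open>The total angle is \<open>pi / 2\<close>, which carries the first vector to
      the second.\<close>
    also have "g (fst ((R ^^ N) p)) = g (snd p)"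
      using rot_iterate_coords[where n = n and \<delta> = \<delta> and k = N and p = p] \<delta>(3)
      by (intro convex_lip_cong[OF lip]) (auto simp: R_def c_def s_def)
    finally show ?thesis by simp
  qed
  have iS: "integrable ?N (\<lambda>p. \<Sum>k<N. (D ((R ^^ k) p))\<^sup>2)"
    by (intro Bochner_Integration.integrable_sum ri(2) iD)
  have "2 * gauss_var n g = (\<integral>p. (\<Sum>k<N. D ((R ^^ k) p))\<^sup>2 \<partial>?N)"
    unfolding gauss_var_pair[OF lip, symmetric] tele ..
  also have "\<dots> \<le> (\<integral>p. real N * (\<Sum>k<N. (D ((R ^^ k) p))\<^sup>2) \<partial>?N)"
  proof (rule integral_mono')
    show "integrable ?N (\<lambda>p. real N * (\<Sum>k<N. (D ((R ^^ k) p))\<^sup>2))" by (rule integrable_mult_right[OF iS])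
    show "(\<Sum>k<N. D ((R ^^ k) p))\<^sup>2 \<le> real N * (\<Sum>k<N. (D ((R ^^ k) p))\<^sup>2)" for p
      using sum_squared_le_sum_of_squares[of "\<lambda>k. D ((R ^^ k) p)" "{..<N}"] by (simp add: mult.commute)
    show "0 \<le> real N * (\<Sum>k<N. (D ((R ^^ k) p))\<^sup>2)" for p by (simp add: sum_nonneg)
  qed
  also have "\<dots> = real N * (\<Sum>k<N. \<integral>p. (D ((R ^^ k) p))\<^sup>2 \<partial>?N)"
    by (subst integral_mult_right_zero, subst Bochner_Integration.integral_sum) (auto intro: ri(2) iD)
  also have "\<dots> = (real N)\<^sup>2 * (\<integral>p. (D p)\<^sup>2 \<partial>?N)"
    by (simp only: ri(3) sum_constant card_lessThan power2_eq_square[of "real N"] mult.assoc)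
  also have "\<dots> \<le> (real N)\<^sup>2 * (32 * (1 - c)\<^sup>2 * L\<^sup>2 * n + 32 * s\<^sup>2 * ?E)"
    by (intro mult_left_mono ED) simp
  also have "\<dots> = 2 * (16 * (real N * (1 - c))\<^sup>2 * (L\<^sup>2 * n) + 16 * (real N * s)\<^sup>2 * ?E)"
    by (simp add: power_mult_distrib distrib_left mult_ac)
  finally have "gauss_var n g \<le> 16 * (real N * (1 - c))\<^sup>2 * (L\<^sup>2 * n) + 16 * (real N * s)\<^sup>2 * ?E"
    by simp
  also have "\<dots> \<le> 16 * (2 / real N)\<^sup>2 * (L\<^sup>2 * n) + 16 * 2\<^sup>2 * ?E"
  proof -
    have s: "0 \<le> s" "s \<le> \<delta>" unfolding s_def using \<delta> by (auto intro: sin_ge_zero sin_x_le_x)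
    have Nd: "real N * \<delta> \<le> 2" using \<delta>(3) pi_less_4 by simp
    have "real N * s \<le> 2" using s Nd mult_left_mono[of s \<delta> "real N"] by linarith
    then have 1: "(real N * s)\<^sup>2 \<le> 2\<^sup>2" using s by (intro power_mono) auto
    have sin2: "0 \<le> sin (\<delta> / 2)" "sin (\<delta> / 2) \<le> \<delta> / 2"
      by (rule sin_ge_zero sin_x_le_x; use \<delta> in simp)+
    have "1 - c = 2 * (sin (\<delta> / 2))\<^sup>2" using cos_double_sin[of "\<delta> / 2"] by (simp add: c_def)
    also have "\<dots> \<le> 2 * (\<delta> / 2)\<^sup>2" using sin2 by (intro mult_left_mono power_mono) auto
    finally have "(real N)\<^sup>2 * (1 - c) \<le> (real N * \<delta>)\<^sup>2 / 2"
      using mult_left_mono[of "1 - c" "\<delta>\<^sup>2 / 2" "(real N)\<^sup>2"] by (simp add: power2_eq_square algebra_simps)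
    also have "\<dots> \<le> 2\<^sup>2 / 2" using Nd \<delta> by (intro divide_right_mono power_mono) auto
    finally have "real N * (1 - c) \<le> 2 / real N"
      using N by (simp add: field_simps power2_eq_square)
    then have 2: "(real N * (1 - c))\<^sup>2 \<le> (2 / real N)\<^sup>2" by (intro power_mono) (auto simp: c_def)
    have "0 \<le> ?E" by simp
    then show ?thesis using 1 2 by (intro add_mono mult_right_mono mult_left_mono) auto
  qed
  finally show ?thesis by (simp add: power_divide)
qed

lemma poincare: "gauss_var n g \<le> 64 * (\<integral>x. ip n (\<xi> x) (\<xi> x) \<partial>gauss n)"
proof (rule LIMSEQ_le_const)
  have "(\<lambda>N. 64 * (\<integral>x. ip n (\<xi> x) (\<xi> x) \<partial>gauss n) + 64 * L\<^sup>2 * n * (inverse (real N) * inverse (real N)))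
      \<longlonglongrightarrow> 64 * (\<integral>x. ip n (\<xi> x) (\<xi> x) \<partial>gauss n) + 64 * L\<^sup>2 * n * (0 * 0)"
    by (intro tendsto_intros lim_inverse_n)
  then show "(\<lambda>N. 64 * (\<integral>x. ip n (\<xi> x) (\<xi> x) \<partial>gauss n) + 64 * L\<^sup>2 * n / (real N)\<^sup>2)
      \<longlonglongrightarrow> 64 * (\<integral>x. ip n (\<xi> x) (\<xi> x) \<partial>gauss n)"
    by (simp add: divide_inverse power2_eq_square)
  show "\<exists>N0. \<forall>N\<ge>N0. gauss_var n g \<le> 64 * (\<integral>x. ip n (\<xi> x) (\<xi> x) \<partial>gauss n) + 64 * L\<^sup>2 * n / (real N)\<^sup>2"
    using poincare_rotations by blast
qed

end

section \<open>Conditioning on one vector of the mixture, and the dimension-free variance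
  bound\<close>

lemma subgradient_field_smooth:
  assumes F: "convex_lip n L F" and ab: "0 < a" "a \<le> 1" "0 < b"
  shows "subgradient_field n L (smooth n a b F) (smooth_grad n a b F)"
proof
  show "convex_lip n L (smooth n a b F)" using ab by (intro convex_lip_smooth[OF F]) auto
qed (use ab in \<open>auto intro: smooth_subgradient[OF F] measurable_smooth_grad[OF F]\<close>)

text \<open>Rotation invariance read off in the first component. The outer function \<open>h\<close>
  lets the lemma serve means, second moments and a tail indicator alike.\<close>

lemma gauss_mix:
  assumes ab: "a\<^sup>2 + b\<^sup>2 = 1" "0 < a" and F: "convex_lip n L F"
    and h: "integrable (gauss n) (\<lambda>x. h (F x))" and mh: "h \<in> borel_measurable borel"
  shows "integrable (gauss n \<Otimes>\<^sub>M gauss n) (\<lambda>p. h (F (\<lambda>i. a * fst p i + b * snd p i)))"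
    and "(\<integral>p. h (F (\<lambda>i. a * fst p i + b * snd p i)) \<partial>(gauss n \<Otimes>\<^sub>M gauss n)) = (\<integral>x. h (F x) \<partial>gauss n :: real)"
    and "(\<integral>x. \<integral>y. h (F (\<lambda>i. a * x i + b * y i)) \<partial>gauss n \<partial>gauss n) = (\<integral>x. h (F x) \<partial>gauss n :: real)"
    and "integrable (gauss n) (\<lambda>x. \<integral>y. h (F (\<lambda>i. a * x i + b * y i)) \<partial>gauss n)"
proof -
  let ?N = "gauss n \<Otimes>\<^sub>M gauss n"
  interpret g: prob_space "gauss n" by (rule prob_space_gauss)
  interpret gg: pair_prob_space "gauss n" "gauss n" ..
  have mF: "F \<in> borel_measurable (gauss n)" by (rule convex_lip_measurable_gauss[OF F])
  have m: "(\<lambda>p. h (F (fst p))) \<in> borel_measurable ?N"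
    by (rule measurable_compose[OF measurable_fst measurable_compose[OF mF mh]])
  note ri = rot_iterate[OF ab m, where k = 1, simplified funpow.simps One_nat_def comp_id rot_def fst_conv, unfolded convex_lip_restrict[OF F]]
  note i = integrable_gauss_pair_fst[OF h]
  show 1: "integrable ?N (\<lambda>p. h (F (\<lambda>i. a * fst p i + b * snd p i)))" by (rule ri(2)[OF i(1)])
  show 2: "(\<integral>p. h (F (\<lambda>i. a * fst p i + b * snd p i)) \<partial>?N) = (\<integral>x. h (F x) \<partial>gauss n)"
    using ri(3) i(2) by simp
  show "(\<integral>x. \<integral>y. h (F (\<lambda>i. a * x i + b * y i)) \<partial>gauss n \<partial>gauss n) = (\<integral>x. h (F x) \<partial>gauss n)"
    using gg.integral_fst'[OF 1] 2 by simp
  show "integrable (gauss n) (\<lambda>x. \<integral>y. h (F (\<lambda>i. a * x i + b * y i)) \<partial>gauss n)"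
    using gg.integrable_fst'[OF 1] by simp
qed

lemma le_one_if_sum_squares: "a\<^sup>2 + b\<^sup>2 = 1 \<Longrightarrow> (a::real) \<le> 1"
  by (rule power2_le_imp_le[of a 1]) (smt (verit) zero_le_power2 one_power2, simp)

text \<open>Law of total variance, conditioning the mixture on its first vector;
  \<open>smooth n a b F\<close> is the conditional mean.\<close>

lemma gauss_var_smooth_decomposition:
  assumes ab: "a\<^sup>2 + b\<^sup>2 = 1" "0 < a" and F: "convex_lip n L F"
  shows "integrable (gauss n) (\<lambda>x. gauss_var n (\<lambda>y. F (\<lambda>i. a * x i + b * y i)))"
    and "gauss_var n F = (\<integral>x. gauss_var n (\<lambda>y. F (\<lambda>i. a * x i + b * y i)) \<partial>gauss n) + gauss_var n (smooth n a b F)"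
proof -
  have a1: "a \<le> 1" by (rule le_one_if_sum_squares[OF ab(1)])
  have s: "integrable (gauss n) (\<lambda>x. (smooth n a b F x)\<^sup>2)"
    using ab a1 by (intro integrable_convex_lip_square[OF convex_lip_smooth[OF F]]) auto
  have eq: "gauss_var n (\<lambda>y. F (\<lambda>i. a * x i + b * y i))
     = (\<integral>y. (F (\<lambda>i. a * x i + b * y i))\<^sup>2 \<partial>gauss n) - (smooth n a b F x)\<^sup>2" for x
    by (simp add: gauss_var_def smooth_def)
  have m2': "integrable (gauss n) (\<lambda>x. \<integral>y. (F (\<lambda>i. a * x i + b * y i))\<^sup>2 \<partial>gauss n)"
    "(\<integral>x. \<integral>y. (F (\<lambda>i. a * x i + b * y i))\<^sup>2 \<partial>gauss n \<partial>gauss n) = (\<integral>x. (F x)\<^sup>2 \<partial>gauss n)"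
    using gauss_mix[OF ab F, of "\<lambda>t. t\<^sup>2"] integrable_convex_lip_square[OF F] by simp_all
  have m1': "(\<integral>x. smooth n a b F x \<partial>gauss n) = (\<integral>x. F x \<partial>gauss n)"
    using gauss_mix(3)[OF ab F, of "\<lambda>t. t"] integrable_convex_lip[OF F] by (simp add: smooth_def)
  show "integrable (gauss n) (\<lambda>x. gauss_var n (\<lambda>y. F (\<lambda>i. a * x i + b * y i)))"
    unfolding eq by (intro Bochner_Integration.integrable_diff m2' s)
  show "gauss_var n F = (\<integral>x. gauss_var n (\<lambda>y. F (\<lambda>i. a * x i + b * y i)) \<partial>gauss n) + gauss_var n (smooth n a b F)"
  proof -
    have e: "(\<integral>x. gauss_var n (\<lambda>y. F (\<lambda>i. a * x i + b * y i)) \<partial>gauss n)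
        = (\<integral>x. (F x)\<^sup>2 \<partial>gauss n) - (\<integral>x. (smooth n a b F x)\<^sup>2 \<partial>gauss n)"
      by (simp only: eq Bochner_Integration.integral_diff[OF m2'(1) s] m2'(2))
    show ?thesis unfolding e by (simp add: gauss_var_def m1')
  qed
qed

text \<open>For fixed \<open>x\<close> the mixture is Lipschitz in the noise with constant
  \<open>b * L\<close>, which gives the first term; the Poincare inequality bounds the variance of
  the conditional mean. \<open>v\<close> is a parameter because the lemma is used first with bounds
  that still depend on \<open>n\<close> and later with 128.\<close>

lemma gauss_var_le_smooth_energy:
  assumes ab: "a\<^sup>2 + b\<^sup>2 = 1" "0 < a" "0 < b" and F: "convex_lip n L F"
    and v: "\<And>L F. convex_lip n L F \<Longrightarrow> gauss_var n F \<le> v * L\<^sup>2"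
  shows "gauss_var n F \<le> v * b\<^sup>2 * L\<^sup>2 + 64 * (\<integral>x. ip n (smooth_grad n a b F x) (smooth_grad n a b F x) \<partial>gauss n)"
proof -
  interpret g: prob_space "gauss n" by (rule prob_space_gauss)
  have a1: "a \<le> 1" by (rule le_one_if_sum_squares[OF ab(1)])
  note d = gauss_var_smooth_decomposition[OF ab(1,2) F]
  have "(\<integral>x. gauss_var n (\<lambda>y. F (\<lambda>i. a * x i + b * y i)) \<partial>gauss n) \<le> (\<integral>x. v * b\<^sup>2 * L\<^sup>2 \<partial>gauss n)"
  proof (rule integral_mono[OF d(1)])
    fix x
    show "gauss_var n (\<lambda>y. F (\<lambda>i. a * x i + b * y i)) \<le> v * b\<^sup>2 * L\<^sup>2"
      using v[OF convex_lip_affine[OF F, of b "\<lambda>i. a * x i"]] by (simp add: power_mult_distrib mult_ac)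
  qed simp
  then show ?thesis
    using d(2) subgradient_field.poincare[OF subgradient_field_smooth[OF F ab(2) a1 ab(3)]]
    by (simp add: g.prob_space)
qed

lemma gauss_var_le_dimension:
  assumes F: "convex_lip n L F"
  shows "gauss_var n F \<le> (8 * real n) * L\<^sup>2"
proof -
  have "gauss_var n F \<le> (\<integral>x. (F x - F (\<lambda>_. 0))\<^sup>2 \<partial>gauss n)"
    using second_moment_about(1)[OF F, of "F (\<lambda>_. 0)"] by simp
  also have "\<dots> \<le> (\<integral>x. L\<^sup>2 * ip n x x \<partial>gauss n)"
  proof (rule integral_mono[OF second_moment_about(2)[OF F] integrable_mult_right[OF integrable_ip_self]])
    fix x
    have "\<bar>F x - F (\<lambda>_. 0)\<bar>\<^sup>2 \<le> (L * L2_set x {..<n})\<^sup>2"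
      using convex_lipD(2)[OF F, of x "\<lambda>_. 0"] by (intro power_mono) auto
    then show "(F x - F (\<lambda>_. 0))\<^sup>2 \<le> L\<^sup>2 * ip n x x" by (simp add: power_mult_distrib ip_self_L2_set)
  qed
  also have "\<dots> \<le> L\<^sup>2 * (8 * n)"
    using integral_ip_self_le[of n] by (simp add: mult_left_mono)
  finally show ?thesis by (simp add: mult.commute)
qed

text \<open>Splitting off half of the noise improves a bound \<open>v\<close> that is uniform over all convex Lipschitz
  functions to \<open>v / 2 + 64\<close>; iterating from the crude bound removes the dimension.\<close>

lemma gauss_var_le_iterate:
  "convex_lip n L F \<Longrightarrow> gauss_var n F \<le> (8 * real n / 2 ^ k + 128) * L\<^sup>2"
proof (induction k arbitrary: L F)
  case 0
  then show ?case using gauss_var_le_dimension[OF 0] by (simp add: algebra_simps) (smt (verit) zero_le_power2)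
next
  case (Suc k)
  \<comment> \<open>Equal weights halve the previous bound. The summand 64 is the Poincare constant
    combined with \<open>ip_le\<close>, and 128 is the fixed point of
    \<open>v \<mapsto> v / 2 + 64\<close>.\<close>
  define a where "a = 1 / sqrt 2"
  have a: "a\<^sup>2 = 1 / 2" "0 < a" "a \<le> 1" by (auto simp: a_def power_divide)
  interpret g: prob_space "gauss n" by (rule prob_space_gauss)
  interpret subgradient_field n L "smooth n a a F" "smooth_grad n a a F"
    by (rule subgradient_field_smooth[OF Suc.prems]) (use a in auto)
  have "(\<integral>x. ip n (smooth_grad n a a F x) (smooth_grad n a a F x) \<partial>gauss n) \<le> (\<integral>x. L\<^sup>2 \<partial>gauss n)"
    by (intro integral_mono integrable_ip ip_le) simp
  moreover have "gauss_var n F \<le> (8 * real n / 2 ^ k + 128) * a\<^sup>2 * L\<^sup>2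
      + 64 * (\<integral>x. ip n (smooth_grad n a a F x) (smooth_grad n a a F x) \<partial>gauss n)"
  proof (rule gauss_var_le_smooth_energy[OF _ a(2) a(2) Suc.prems])
    show "a\<^sup>2 + a\<^sup>2 = 1" using a by simp
  qed (rule Suc.IH)
  ultimately have "gauss_var n F \<le> (8 * real n / 2 ^ k + 128) * (1 / 2) * L\<^sup>2 + 64 * L\<^sup>2"
    by (simp add: g.prob_space a)
  also have "\<dots> = (8 * real n / 2 ^ Suc k + 128) * L\<^sup>2" by (simp add: algebra_simps)
  finally show ?case .
qed

lemma gauss_var_le:
  assumes F: "convex_lip n L F"
  shows "gauss_var n F \<le> 128 * L\<^sup>2"
proof (rule LIMSEQ_le_const)
  have "(\<lambda>k. (8 * real n * (1 / 2) ^ k + 128) * L\<^sup>2) \<longlonglongrightarrow> (8 * real n * 0 + 128) * L\<^sup>2"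
    by (intro tendsto_intros LIMSEQ_realpow_zero) auto
  then show "(\<lambda>k. (8 * real n * (1 / 2) ^ k + 128) * L\<^sup>2) \<longlonglongrightarrow> 128 * L\<^sup>2"
    by (simp only: mult_zero_right add_0)
qed (use gauss_var_le_iterate[OF F] in \<open>auto simp: power_divide\<close>)

section \<open>Tails of functions with large variance\<close>

text \<open>A pointwise Paley-Zygmund device: once integrated, it turns a lower bound on the mean of
  \<open>d\<close> and second-moment bounds into a lower bound on the probability that
  \<open>\<kappa> \<le> d\<close>. Above the threshold it is
  \<open>d \<le> d\<^sup>2 / (2 * q) + q / 2\<close>, with \<open>q\<close> free to be
  chosen.\<close>

lemma truncation_bound:
  fixes d d0 \<kappa> q e :: real
  assumes "d \<le> d0 + e" "0 \<le> e" "0 < q" "0 \<le> \<kappa>"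
  shows "d \<le> \<kappa> + (d0\<^sup>2 + e\<^sup>2) / q + q / 2 * (if \<kappa> \<le> d then 1 else 0)"
proof (cases "\<kappa> \<le> d")
  case True
  then have "d\<^sup>2 \<le> (d0 + e)\<^sup>2" using assms by (intro power_mono) auto
  also have "\<dots> \<le> 2 * d0\<^sup>2 + 2 * e\<^sup>2" by (rule square_sum_le)
  finally have d2: "d\<^sup>2 \<le> 2 * (d0\<^sup>2 + e\<^sup>2)" by simp
  have "0 \<le> (d - q)\<^sup>2" by simp
  then have "2 * q * d \<le> d\<^sup>2 + q\<^sup>2" by (simp add: power2_eq_square algebra_simps)
  then have "2 * q * d \<le> 2 * (d0\<^sup>2 + e\<^sup>2) + q\<^sup>2" using d2 by simp
  then have "d \<le> (d0\<^sup>2 + e\<^sup>2) / q + q / 2"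
    using \<open>0 < q\<close> by (simp add: field_simps power2_eq_square)
  then show ?thesis using True assms by simp
next
  case False
  then show ?thesis using assms by (simp add: add_increasing2)
qed

locale gaussian_deviation =
  fixes n :: nat and L A :: real and F :: "(nat \<Rightarrow> real) \<Rightarrow> real"
  assumes F: "convex_lip n L F" and L: "0 < L" and A: "0 < A" and var: "A\<^sup>2 * L\<^sup>2 \<le> gauss_var n F"
begin

text \<open>With \<open>b\<^sup>2 = A\<^sup>2 / 256\<close> the variance \<open>128 b\<^sup>2 L\<^sup>2\<close> lost by smoothing is at most half of the
  total, and \<open>\<kappa> = b A\<^sup>2 / 256\<close> is half of the resulting gain in the mean per unit of \<open>t L\<close>.\<close>

definition b where "b = A / 16"
definition a where "a = sqrt (1 - b\<^sup>2)"
definition \<kappa> where "\<kappa> = A ^ 3 / 4096"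
definition \<mu> where "\<mu> = (\<integral>x. F x \<partial>gauss n)"
abbreviation \<xi> where "\<xi> \<equiv> smooth_grad n a b F"

text \<open>\<open>A\<close> is given as an arbitrary positive number, but the variance hypothesis
  against \<open>gauss_var_le\<close> forces \<open>A\<^sup>2 \<le> 128\<close>. Hence
  \<open>b\<^sup>2 \<le> 1 / 2\<close>, and the square root defining \<open>a\<close> is
  positive.\<close>

lemma ab: "a\<^sup>2 + b\<^sup>2 = 1" "0 < a" "a \<le> 1" "0 < b" "b \<le> 1"
proof -
  have "A\<^sup>2 * L\<^sup>2 \<le> 128 * L\<^sup>2" using var gauss_var_le[OF F] by simp
  then have "A\<^sup>2 \<le> 128" using L by simp
  then have b: "b\<^sup>2 \<le> 1 / 2" by (simp add: b_def power_divide)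
  then show 1: "a\<^sup>2 + b\<^sup>2 = 1" by (simp add: a_def)
  then show "a \<le> 1" by (rule le_one_if_sum_squares)
  show "0 < a" using b by (simp add: a_def)
  show "0 < b" using A by (simp add: b_def)
  show "b \<le> 1" using 1 by (intro le_one_if_sum_squares[of b a]) simp
qed

lemma \<kappa>_pos: "0 < \<kappa>"
  using A by (simp add: \<kappa>_def)

sublocale subgradient_field n L "smooth n a b F" \<xi>
  by (rule subgradient_field_smooth[OF F ab(2-4)])

lemma energy_ge: "A\<^sup>2 * L\<^sup>2 / 128 \<le> (\<integral>x. ip n (\<xi> x) (\<xi> x) \<partial>gauss n)"
proof -
  have "gauss_var n F \<le> 128 * b\<^sup>2 * L\<^sup>2 + 64 * (\<integral>x. ip n (\<xi> x) (\<xi> x) \<partial>gauss n)"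
    by (rule gauss_var_le_smooth_energy[OF ab(1,2,4) F gauss_var_le])
  then show ?thesis using var by (simp add: b_def power_divide)
qed

context
  fixes t :: real
  assumes t: "1 \<le> t"
begin

definition h where "h x i = (t / L) * \<xi> x i" for x i
definition D where "D p = F (\<lambda>i. a * fst p i + b * (snd p i + h (fst p) i)) - \<mu>" for p
definition S where "S p = (if \<kappa> * t * L \<le> D p then 1 else 0 :: real)" for p

lemma ip_h: "ip n (h x) (h x) \<le> t\<^sup>2"
proof -
  have "ip n (h x) (h x) = (t / L)\<^sup>2 * ip n (\<xi> x) (\<xi> x)"
    unfolding h_def[abs_def] ip_scale_left ip_scale_right by (simp add: power2_eq_square)
  also have "\<dots> \<le> (t / L)\<^sup>2 * L\<^sup>2" by (intro mult_left_mono ip_le) simp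
  finally show ?thesis using L by (simp add: power_divide)
qed

lemma measurable_D [measurable]: "D \<in> borel_measurable (gauss n \<Otimes>\<^sub>M gauss n)"
proof -
  have "(\<lambda>p. F (\<lambda>i. a * fst p i + b * (snd p i + h (fst p) i))) \<in> borel_measurable (gauss n \<Otimes>\<^sub>M gauss n)"
    unfolding h_def by (rule convex_lip_measurable[OF F]) measurable
  then show ?thesis unfolding D_def by measurable
qed

lemma measurable_S [measurable]: "S \<in> borel_measurable (gauss n \<Otimes>\<^sub>M gauss n)"
  unfolding S_def by measurable

lemma D_near: "\<bar>D p - (F (\<lambda>i. a * fst p i + b * snd p i) - \<mu>)\<bar> \<le> L * t"
proof -
  let ?u = "\<lambda>i. a * fst p i + b * (snd p i + h (fst p) i)" and ?v = "\<lambda>i. a * fst p i + b * snd p i"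
  have "?u i - ?v i = b * h (fst p) i" for i by (simp add: algebra_simps)
  then have "L2_set (\<lambda>i. ?u i - ?v i) {..<n} = b * L2_set (h (fst p)) {..<n}"
    using L2_set_right_distrib[of b "h (fst p)" "{..<n}"] ab by simp
  also have "\<dots> \<le> 1 * t"
  proof (rule mult_mono)
    show "L2_set (h (fst p)) {..<n} \<le> t"
      using t ip_h[of "fst p"] by (subst ip_self_le_iff) auto
  qed (use ab in auto)
  finally have "L * L2_set (\<lambda>i. ?u i - ?v i) {..<n} \<le> L * t" using L by simp
  then have "\<bar>F ?u - F ?v\<bar> \<le> L * t"
    using convex_lipD(2)[OF F, of ?u ?v] by (rule order_trans[rotated])
  then show ?thesis by (simp add: D_def)
qed

lemma integrable_D: "integrable (gauss n \<Otimes>\<^sub>M gauss n) D"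
proof (rule Bochner_Integration.integrable_bound)
  interpret g: prob_space "gauss n" by (rule prob_space_gauss)
  interpret gg: pair_prob_space "gauss n" "gauss n" ..
  have "integrable (gauss n \<Otimes>\<^sub>M gauss n) (\<lambda>p. F (\<lambda>i. a * fst p i + b * snd p i))"
    using gauss_mix(1)[OF ab(1,2) F, of "\<lambda>t. t"] integrable_convex_lip[OF F] by simp
  then show "integrable (gauss n \<Otimes>\<^sub>M gauss n) (\<lambda>p. \<bar>F (\<lambda>i. a * fst p i + b * snd p i) - \<mu>\<bar> + L * t)"
    by simp
  have "\<bar>D p\<bar> \<le> \<bar>F (\<lambda>i. a * fst p i + b * snd p i) - \<mu>\<bar> + L * t" for p
    using D_near[of p] by linarith
  then show "AE p in gauss n \<Otimes>\<^sub>M gauss n. norm (D p) \<le> norm (\<bar>F (\<lambda>i. a * fst p i + b * snd p i) - \<mu>\<bar> + L * t)"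
    by (auto intro!: AE_I2 order_trans[OF _ abs_ge_self])
qed measurable

text \<open>With \<open>x\<close> fixed, translating the noise by \<open>h x\<close> is the same as
  evaluating the smoothed function at \<open>x + (b / a) * h x\<close>. Because \<open>h x\<close>
  points along the subgradient, the gain is at least a multiple of its squared length, whose mean
  \<open>energy_ge\<close> bounds below. Replacing \<open>b / a\<close> by the smaller
  \<open>b\<close> keeps \<open>a\<close> out of the constants.\<close>

lemma integral_D_ge: "2 * \<kappa> * t * L \<le> (\<integral>p. D p \<partial>(gauss n \<Otimes>\<^sub>M gauss n))"
proof -
  interpret g: prob_space "gauss n" by (rule prob_space_gauss)
  interpret gg: pair_prob_space "gauss n" "gauss n" ..
  let ?E = "\<integral>x. ip n (\<xi> x) (\<xi> x) \<partial>gauss n"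
  have mean: "(\<integral>x. smooth n a b F x \<partial>gauss n) = \<mu>"
    using gauss_mix(3)[OF ab(1,2) F, of "\<lambda>t. t"] integrable_convex_lip[OF F] by (simp add: smooth_def \<mu>_def)
  have int: "integrable (gauss n) (smooth n a b F)"
    by (rule integrable_convex_lip[OF lip])
  have inner: "smooth n a b F x + (b / a) * (t / L) * ip n (\<xi> x) (\<xi> x) - \<mu> \<le> (\<integral>y. D (x, y) \<partial>gauss n)" for x
  proof -
    have "smooth n a b F x + (b / a) * (t / L) * ip n (\<xi> x) (\<xi> x)
        = smooth n a b F x + ip n (\<xi> x) (\<lambda>i. (x i + (b / a) * h x i) - x i)"
      by (simp only: add_diff_cancel_left' ip_scale_right h_def mult.assoc)
    also have "\<dots> \<le> smooth n a b F (\<lambda>i. x i + (b / a) * h x i)" by (rule sub)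
    also have "\<dots> = (\<integral>y. F (\<lambda>i. a * x i + b * (y i + h x i)) \<partial>gauss n)"
      unfolding smooth_def using ab(2) by (simp add: distrib_left add_ac)
    finally have le: "smooth n a b F x + (b / a) * (t / L) * ip n (\<xi> x) (\<xi> x)
      \<le> (\<integral>y. F (\<lambda>i. a * x i + b * (y i + h x i)) \<partial>gauss n)" .
    have "integrable (gauss n) (\<lambda>y. F (\<lambda>i. (a * x i + b * h x i) + b * y i))"
      by (rule integrable_convex_lip[OF convex_lip_affine[OF F]])
    then have "integrable (gauss n) (\<lambda>y. F (\<lambda>i. a * x i + b * (y i + h x i)))"
      by (simp add: distrib_left add_ac)
    then have "(\<integral>y. D (x, y) \<partial>gauss n) = (\<integral>y. F (\<lambda>i. a * x i + b * (y i + h x i)) \<partial>gauss n) - \<mu>"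
      by (simp add: D_def g.prob_space)
    then show ?thesis using le by simp
  qed
  have "2 * \<kappa> * t * L = b * (t / L) * (A\<^sup>2 * L\<^sup>2 / 128)"
    using L by (simp add: \<kappa>_def b_def power2_eq_square power3_eq_cube)
  also have "\<dots> \<le> (b / a) * (t / L) * ?E"
  proof (intro mult_mono energy_ge)
    show "b \<le> b / a" using ab by (simp add: field_simps)
  qed (use ab L t in auto)
  also have "\<dots> = (\<integral>x. smooth n a b F x + (b / a) * (t / L) * ip n (\<xi> x) (\<xi> x) - \<mu> \<partial>gauss n)"
    using int integrable_ip by (simp add: mean g.prob_space)
  also have "\<dots> \<le> (\<integral>x. \<integral>y. D (x, y) \<partial>gauss n \<partial>gauss n)"
    using int integrable_ip gg.integrable_fst'[OF integrable_D] by (intro integral_mono inner) simp_all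
  also have "\<dots> = (\<integral>p. D p \<partial>(gauss n \<Otimes>\<^sub>M gauss n))"
    by (rule gg.integral_fst'[OF integrable_D])
  finally show ?thesis .
qed

lemma integrable_S: "integrable (gauss n \<Otimes>\<^sub>M gauss n) S"
proof -
  interpret g: prob_space "gauss n" by (rule prob_space_gauss)
  interpret gg: pair_prob_space "gauss n" "gauss n" ..
  show ?thesis by (rule gg.integrable_const_bound[where B = 1]) (auto simp: S_def)
qed

lemma integral_S_ge: "\<kappa>\<^sup>2 / 258 \<le> (\<integral>p. S p \<partial>(gauss n \<Otimes>\<^sub>M gauss n))"
proof -
  let ?N = "gauss n \<Otimes>\<^sub>M gauss n"
  interpret g: prob_space "gauss n" by (rule prob_space_gauss)
  interpret gg: pair_prob_space "gauss n" "gauss n" ..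
  \<comment> \<open>This makes the second-moment term, at most
    \<open>129 * L\<^sup>2 * t\<^sup>2 / q\<close>, no larger than half of
    \<open>\<kappa> * t * L\<close>. Of the mean \<open>2 * \<kappa> * t * L\<close> the threshold
    takes one half and this term a quarter; the last quarter must come from
    \<open>S\<close>.\<close>
  define q where "q = 258 * t * L / \<kappa>"
  have q: "0 < q" using t L \<kappa>_pos by (simp add: q_def)
  define D0 where "D0 p = F (\<lambda>i. a * fst p i + b * snd p i) - \<mu>" for p
  have i0: "integrable ?N (\<lambda>p. (D0 p)\<^sup>2)" and e0: "(\<integral>p. (D0 p)\<^sup>2 \<partial>?N) = gauss_var n F"
    using gauss_mix(1,2)[OF ab(1,2) F, of "\<lambda>s. (s - \<mu>)\<^sup>2"] second_moment_about[OF F, of \<mu>]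
    by (simp_all add: D0_def \<mu>_def)
  have "2 * \<kappa> * t * L \<le> (\<integral>p. D p \<partial>?N)" by (rule integral_D_ge)
  also have "\<dots> \<le> (\<integral>p. \<kappa> * t * L + ((D0 p)\<^sup>2 + (L * t)\<^sup>2) / q + q / 2 * S p \<partial>?N)"
  proof (intro integral_mono integrable_D)
    show "D p \<le> \<kappa> * t * L + ((D0 p)\<^sup>2 + (L * t)\<^sup>2) / q + q / 2 * S p" for p
      unfolding S_def
      using D_near[of p] q t L \<kappa>_pos by (intro truncation_bound) (auto simp: D0_def)
  qed (use i0 integrable_S in auto)
  also have "\<dots> = \<kappa> * t * L + (gauss_var n F + (L * t)\<^sup>2) / q + q / 2 * (\<integral>p. S p \<partial>?N)"
    using i0 e0 integrable_S by (simp add: gg.prob_space)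
  also have "\<dots> \<le> \<kappa> * t * L + \<kappa> * t * L / 2 + q / 2 * (\<integral>p. S p \<partial>?N)"
  proof -
    \<comment> \<open>\<open>t \<ge> 1\<close> lets the variance, of order \<open>L\<^sup>2\<close>,
      be absorbed into the scale \<open>L\<^sup>2 * t\<^sup>2\<close>.\<close>
    have "1 \<le> t\<^sup>2" using t by (simp add: one_le_power)
    then have "gauss_var n F + (L * t)\<^sup>2 \<le> 128 * L\<^sup>2 * t\<^sup>2 + (L * t)\<^sup>2"
      using gauss_var_le[OF F] mult_left_mono[of 1 "t\<^sup>2" "128 * L\<^sup>2"] by simp
    also have "\<dots> = (\<kappa> * t * L / 2) * q" using \<kappa>_pos by (simp add: q_def power2_eq_square)
    finally have "(gauss_var n F + (L * t)\<^sup>2) / q \<le> \<kappa> * t * L / 2" using q by (simp only: pos_divide_le_eq)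
    then show ?thesis by (intro add_mono order_refl)
  qed
  finally have "\<kappa> * t * L \<le> q * (\<integral>p. S p \<partial>?N)"
    unfolding mult.assoc[of 2] by linarith
  then have "\<kappa> * (t * L) \<le> 258 / \<kappa> * (\<integral>p. S p \<partial>?N) * (t * L)" by (simp add: q_def mult_ac)
  then have "\<kappa> \<le> 258 / \<kappa> * (\<integral>p. S p \<partial>?N)"
    by (rule mult_right_le_imp_le) (use t L in simp)
  then show ?thesis using \<kappa>_pos by (simp add: field_simps power2_eq_square)
qed

text \<open>For fixed \<open>x\<close> the translation is constant, and undoing it brings in the
  density \<open>exp (- ip n (h x) y - ip n (h x) (h x) / 2)\<close>, which is at least the stated
  exponential unless \<open>ip n (h x) y > K * t\<close>. As in Chebyshev's inequality, that event
  is discarded by subtracting \<open>(ip n (h x) y)\<^sup>2 / (K * t)\<^sup>2\<close>, which is at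
  least 1 on it and has mean at most \<open>8 / K\<^sup>2\<close>.\<close>

lemma shifted_tail:
  assumes K: "0 < K"
  shows "exp (- K * t - t\<^sup>2 / 2) * ((\<integral>y. S (x, y) \<partial>gauss n) - 8 / K\<^sup>2)
    \<le> (\<integral>y. indicator {\<mu> + \<kappa> * t * L ..} (F (\<lambda>i. a * x i + b * y i)) \<partial>gauss n)"
proof -
  interpret g: prob_space "gauss n" by (rule prob_space_gauss)
  let ?e = "exp (- K * t - t\<^sup>2 / 2)"
  have S_eq: "S (x, y) = indicator {\<mu> + \<kappa> * t * L ..} (F (\<lambda>i. a * x i + b * (y i + h x i)))" for y
    by (auto simp: S_def D_def indicator_def)
  have aff: "convex_lip n (L * \<bar>b\<bar>) (\<lambda>y. F (\<lambda>i. w i + b * y i))" for w by (rule convex_lip_affine[OF F])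
  have mS[measurable]: "(\<lambda>y. S (x, y)) \<in> borel_measurable (gauss n)"
    unfolding S_eq using convex_lip_measurable_gauss[OF aff[of "\<lambda>i. a * x i + b * h x i"]]
    by (simp add: distrib_left add_ac)
  have "AE y in gauss n. norm (S (x, y)) \<le> 1" by (simp add: S_def)
  then have iS: "integrable (gauss n) (\<lambda>y. S (x, y))"
    by (rule g.integrable_const_bound[OF _ mS])
  have "(\<integral>y. indicator {\<mu> + \<kappa> * t * L ..} (F (\<lambda>i. a * x i + b * y i)) \<partial>gauss n)
      = (\<integral>y. S (x, \<lambda>i\<in>{..<n}. y i + (- h x i)) \<partial>gauss n)"
    unfolding S_eq by (intro Bochner_Integration.integral_cong refl arg_cong[where f = "indicator _"] convex_lip_cong[OF F]) simp
  also have "\<dots> = (\<integral>y. exp (ip n (\<lambda>i. - h x i) y - ip n (\<lambda>i. - h x i) (\<lambda>i. - h x i) / 2) * S (x, y) \<partial>gauss n)"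
    by (rule gauss_shift_integral[OF mS])
  also have "\<dots> = (\<integral>y. exp (- ip n (h x) y - ip n (h x) (h x) / 2) * S (x, y) \<partial>gauss n)"
    by (simp add: ip_def sum_negf)
  also have "\<dots> \<ge> (\<integral>y. ?e * (S (x, y) - (ip n (h x) y)\<^sup>2 / (K * t)\<^sup>2) \<partial>gauss n)"
  proof (rule integral_mono)
    show "integrable (gauss n) (\<lambda>y. ?e * (S (x, y) - (ip n (h x) y)\<^sup>2 / (K * t)\<^sup>2))"
      using iS integrable_ip_square[of n "h x"] by simp
    show "integrable (gauss n) (\<lambda>y. exp (- ip n (h x) y - ip n (h x) (h x) / 2) * S (x, y))"
    proof (rule Bochner_Integration.integrable_bound[OF integrable_exp_ip[of n "\<lambda>i. - h x i"]])
      have "(\<lambda>y. ip n (h x) y) \<in> borel_measurable (gauss n)" by measurable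
      then show "(\<lambda>y. exp (- ip n (h x) y - ip n (h x) (h x) / 2) * S (x, y)) \<in> borel_measurable (gauss n)"
        by measurable
      have "exp (- ip n (h x) y - ip n (h x) (h x) / 2) \<le> exp (ip n (\<lambda>i. - h x i) y)" for y
        using ip_self_nonneg[of n "h x"] by (simp add: ip_def sum_negf del: ip_self_nonneg)
      then show "AE y in gauss n. norm (exp (- ip n (h x) y - ip n (h x) (h x) / 2) * S (x, y)) \<le> norm (exp (ip n (\<lambda>i. - h x i) y))"
        by (auto simp: S_def)
    qed
    fix y
    show "?e * (S (x, y) - (ip n (h x) y)\<^sup>2 / (K * t)\<^sup>2) \<le> exp (- ip n (h x) y - ip n (h x) (h x) / 2) * S (x, y)"
    proof (cases "ip n (h x) y \<le> K * t")
      case True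
      then have "?e \<le> exp (- ip n (h x) y - ip n (h x) (h x) / 2)" using ip_h[of x] by simp
      moreover have "?e * (S (x, y) - (ip n (h x) y)\<^sup>2 / (K * t)\<^sup>2) \<le> ?e * S (x, y)"
        by (intro mult_left_mono) auto
      moreover have "0 \<le> S (x, y)" by (simp add: S_def)
      ultimately show ?thesis by (meson mult_right_mono order_trans)
    next
      case False
      then have "(K * t)\<^sup>2 \<le> (ip n (h x) y)\<^sup>2" using K t by (intro power_mono) auto
      then have "1 \<le> (ip n (h x) y)\<^sup>2 / (K * t)\<^sup>2" using K t by (simp add: le_divide_eq)
      then have "S (x, y) - (ip n (h x) y)\<^sup>2 / (K * t)\<^sup>2 \<le> 0" by (simp add: S_def)
      then have "?e * (S (x, y) - (ip n (h x) y)\<^sup>2 / (K * t)\<^sup>2) \<le> 0" by (simp add: mult_le_0_iff)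
      also have "0 \<le> exp (- ip n (h x) y - ip n (h x) (h x) / 2) * S (x, y)" by (simp add: S_def)
      finally show ?thesis .
    qed
  qed
  also have "(\<integral>y. ?e * (S (x, y) - (ip n (h x) y)\<^sup>2 / (K * t)\<^sup>2) \<partial>gauss n)
      = ?e * ((\<integral>y. S (x, y) \<partial>gauss n) - (\<integral>y. (ip n (h x) y)\<^sup>2 \<partial>gauss n) / (K * t)\<^sup>2)"
    using iS integrable_ip_square[of n "h x"] by simp
  finally have le: "?e * ((\<integral>y. S (x, y) \<partial>gauss n) - (\<integral>y. (ip n (h x) y)\<^sup>2 \<partial>gauss n) / (K * t)\<^sup>2)
     \<le> (\<integral>y. indicator {\<mu> + \<kappa> * t * L ..} (F (\<lambda>i. a * x i + b * y i)) \<partial>gauss n)" .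
  have "(\<integral>y. (ip n (h x) y)\<^sup>2 \<partial>gauss n) / (K * t)\<^sup>2 \<le> (8 * t\<^sup>2) / (K * t)\<^sup>2"
    using integral_ip_square_le[of n "h x"] ip_h[of x] by (intro divide_right_mono) auto
  also have "\<dots> = 8 / K\<^sup>2" using t by (simp add: power_mult_distrib)
  finally have "?e * ((\<integral>y. S (x, y) \<partial>gauss n) - 8 / K\<^sup>2)
    \<le> ?e * ((\<integral>y. S (x, y) \<partial>gauss n) - (\<integral>y. (ip n (h x) y)\<^sup>2 \<partial>gauss n) / (K * t)\<^sup>2)"
    by (intro mult_left_mono) auto
  then show ?thesis using le by (rule order_trans)
qed

lemma upper_tail:
  "\<kappa>\<^sup>2 / 600 * exp (- (65 / \<kappa> + 1) * t\<^sup>2) \<le> measure (gauss n) {x\<in>space (gauss n). \<mu> + \<kappa> * t * L \<le> F x}"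
proof -
  interpret g: prob_space "gauss n" by (rule prob_space_gauss)
  interpret gg: pair_prob_space "gauss n" "gauss n" ..
  let ?N = "gauss n \<Otimes>\<^sub>M gauss n" and ?I = "indicator {\<mu> + \<kappa> * t * L ..} :: real \<Rightarrow> real"
  \<comment> \<open>With 65 the loss \<open>8 / K\<^sup>2 = 8 * \<kappa>\<^sup>2 / 4225\<close> is
    less than half of the bound \<open>\<kappa>\<^sup>2 / 258\<close> on the mean of
    \<open>S\<close>, and more than \<open>\<kappa>\<^sup>2 / 600\<close> remains.\<close>
  define K where "K = 65 / \<kappa>"
  have K: "0 < K" using \<kappa>_pos by (simp add: K_def)
  let ?e = "exp (- K * t - t\<^sup>2 / 2)"
  have mF[measurable]: "F \<in> borel_measurable (gauss n)" by (rule convex_lip_measurable_gauss[OF F])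
  have iI: "integrable (gauss n) (\<lambda>x. ?I (F x))"
    by (rule g.integrable_const_bound[where B = 1]) auto
  note mix = gauss_mix[OF ab(1,2) F iI]
  have "\<kappa>\<^sup>2 / 600 * exp (- (65 / \<kappa> + 1) * t\<^sup>2) \<le> (\<kappa>\<^sup>2 / 258 - 8 / K\<^sup>2) * ?e"
  proof (intro mult_mono)
    show "\<kappa>\<^sup>2 / 600 \<le> \<kappa>\<^sup>2 / 258 - 8 / K\<^sup>2" by (simp add: K_def power_divide)
    then show "0 \<le> \<kappa>\<^sup>2 / 258 - 8 / K\<^sup>2" by (rule order_trans[rotated]) simp
    have "K * t \<le> K * t\<^sup>2" using K t by (simp add: self_le_power)
    moreover have "t\<^sup>2 / 2 \<le> t\<^sup>2" by simp
    ultimately have "K * t + t\<^sup>2 / 2 \<le> (K + 1) * t\<^sup>2" unfolding distrib_right by linarith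
    then have "- (K + 1) * t\<^sup>2 \<le> - K * t - t\<^sup>2 / 2" unfolding mult_minus_left by linarith
    then show "exp (- (65 / \<kappa> + 1) * t\<^sup>2) \<le> ?e" unfolding K_def by (simp only: exp_le_cancel_iff)
  qed auto
  also have "\<dots> \<le> ?e * ((\<integral>p. S p \<partial>?N) - 8 / K\<^sup>2)"
    using integral_S_ge by (simp add: mult.commute)
  also have "\<dots> = (\<integral>x. ?e * ((\<integral>y. S (x, y) \<partial>gauss n) - 8 / K\<^sup>2) \<partial>gauss n)"
    using gg.integrable_fst'[OF integrable_S] by (simp add: gg.integral_fst'[OF integrable_S] g.prob_space)
  also have "\<dots> \<le> (\<integral>x. \<integral>y. ?I (F (\<lambda>i. a * x i + b * y i)) \<partial>gauss n \<partial>gauss n)"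
    using gg.integrable_fst'[OF integrable_S] mix(4)
    by (intro integral_mono shifted_tail[OF K]) simp_all
  also have "\<dots> = (\<integral>x. ?I (F x) \<partial>gauss n)" by (rule mix(3)) simp
  also have "\<dots> = (\<integral>x. indicator {x\<in>space (gauss n). \<mu> + \<kappa> * t * L \<le> F x} x \<partial>gauss n)"
    by (intro Bochner_Integration.integral_cong refl) (simp add: indicator_def)
  also have "\<dots> = measure (gauss n) {x\<in>space (gauss n). \<mu> + \<kappa> * t * L \<le> F x}" by simp
  finally show ?thesis .
qed

end

end

section \<open>Equivalence of the three conditions\<close>

text \<open>The infimum in \<open>Lip\<close> is attained: the difference quotient of any two points
  at positive distance is a lower bound for all Lipschitz constants.\<close>

lemma lipschitz_Rn_Lip:
  assumes "lipschitz_Rn n C f"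
  shows "lipschitz_Rn n (Lip n f) f"
  unfolding lipschitz_Rn_def
proof (intro conjI ballI)
  let ?S = "{C. lipschitz_Rn n C f}"
  have ne: "?S \<noteq> {}" using assms by auto
  show "0 \<le> Lip n f" unfolding Lip_def by (rule cInf_greatest[OF ne]) (simp add: lipschitz_Rn_def)
  fix x y assume xy: "x \<in> Rn n" "y \<in> Rn n"
  let ?d = "L2_set (\<lambda>i. x i - y i) {..<n}"
  have le: "\<bar>f x - f y\<bar> \<le> C * ?d" if "C \<in> ?S" for C
    using that xy by (simp add: lipschitz_Rn_def)
  show "\<bar>f x - f y\<bar> \<le> Lip n f * ?d"
  proof (cases "?d = 0")
    case True
    then show ?thesis using le[of C] assms by simp
  next
    case False
    then have d: "0 < ?d" using L2_set_nonneg[of "\<lambda>i. x i - y i" "{..<n}"] by linarith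
    have "\<bar>f x - f y\<bar> / ?d \<le> Lip n f"
      unfolding Lip_def by (rule cInf_greatest[OF ne]) (use le d in \<open>simp add: divide_le_eq\<close>)
    then show ?thesis using d by (simp add: divide_le_eq)
  qed
qed

lemma convex_lip_of_Rn:
  assumes f: "convex_Rn n f" and L: "lipschitz_Rn n L f"
  shows "convex_lip n L (\<lambda>x. f (restrict x {..<n}))"
  unfolding convex_lip_def
proof (intro conjI allI ballI)
  show "0 \<le> L" using L by (simp add: lipschitz_Rn_def)
  fix x y :: "nat \<Rightarrow> real"
  have R: "restrict x {..<n} \<in> Rn n" "restrict y {..<n} \<in> Rn n" by (auto simp: Rn_def)
  have "L2_set (\<lambda>i. restrict x {..<n} i - restrict y {..<n} i) {..<n} = L2_set (\<lambda>i. x i - y i) {..<n}"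
    by (rule L2_set_cong) auto
  then show "\<bar>f (restrict x {..<n}) - f (restrict y {..<n})\<bar> \<le> L * L2_set (\<lambda>i. x i - y i) {..<n}"
    using L R unfolding lipschitz_Rn_def by metis
  fix u :: real assume "u \<in> {0..1}"
  moreover have "(\<lambda>i\<in>{..<n}. (1 - u) * restrict x {..<n} i + u * restrict y {..<n} i)
      = restrict (\<lambda>i. (1 - u) * x i + u * y i) {..<n}"
    by (auto simp: restrict_def)
  ultimately show "f (restrict (\<lambda>i. (1 - u) * x i + u * y i) {..<n})
      \<le> (1 - u) * f (restrict x {..<n}) + u * f (restrict y {..<n})"
    using f R unfolding convex_Rn_def by metis
qed

text \<open>The values of \<open>f\<close> outside \<open>Rn n\<close> are arbitrary. Precomposing
  with the restriction gives a function that satisfies \<open>convex_lip\<close> on the whole type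
  and is unchanged on the probability space, so the three conditions can be studied for it.\<close>

lemma admissible_extension:
  assumes "admissible n f m"
  obtains F where "convex_lip n (Lip n f) F" "\<And>x. x \<in> space (gauss n) \<Longrightarrow> F x = f x" "is_median (gauss n) F m"
proof
  let ?F = "\<lambda>x. f (restrict x {..<n})"
  show eq: "?F x = f x" if "x \<in> space (gauss n)" for x
    using that by (simp add: space_gauss Rn_def PiE_def extensional_restrict)
  show "convex_lip n (Lip n f) ?F"
    using assms lipschitz_Rn_Lip convex_lip_of_Rn unfolding admissible_def by blast
  have "{x \<in> space (gauss n). ?F x \<le> m} = {x \<in> space (gauss n). f x \<le> m}"
    "{x \<in> space (gauss n). ?F x \<ge> m} = {x \<in> space (gauss n). f x \<ge> m}"
    using eq by auto
  then show "is_median (gauss n) ?F m"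
    using assms by (simp only: admissible_def is_median_def)
qed

section \<open>Median, mean and moments\<close>

text \<open>Chebyshev on the side of the median away from the mean: it has probability at least 1/2,
  and there \<open>F\<close> differs from its mean by at least the gap.\<close>

lemma median_mean:
  assumes F: "convex_lip n L F" and m: "is_median (gauss n) F m"
  shows "((\<integral>x. F x \<partial>gauss n) - m)\<^sup>2 \<le> 2 * gauss_var n F"
proof -
  interpret g: prob_space "gauss n" by (rule prob_space_gauss)
  define \<mu> where "\<mu> = (\<integral>x. F x \<partial>gauss n)"
  have mF[measurable]: "F \<in> borel_measurable (gauss n)" by (rule convex_lip_measurable_gauss[OF F])
  define B where "B = (if m \<le> \<mu> then {x\<in>space (gauss n). F x \<le> m} else {x\<in>space (gauss n). F x \<ge> m})"
  have B[measurable]: "B \<in> sets (gauss n)" unfolding B_def by simp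
  have mB: "1 / 2 \<le> measure (gauss n) B" using m by (auto simp: B_def is_median_def)
  have "(\<mu> - m)\<^sup>2 * (1 / 2) \<le> (\<mu> - m)\<^sup>2 * measure (gauss n) B"
    by (intro mult_left_mono mB) simp
  also have "\<dots> = (\<integral>x. (\<mu> - m)\<^sup>2 * indicator B x \<partial>gauss n)" using B by simp
  also have "\<dots> \<le> (\<integral>x. (F x - \<mu>)\<^sup>2 \<partial>gauss n)"
  proof (rule integral_mono)
    show "integrable (gauss n) (\<lambda>x. (\<mu> - m)\<^sup>2 * indicator B x)"
      by (intro integrable_mult_right integrable_real_indicator B) (simp add: less_top[symmetric])
    show "integrable (gauss n) (\<lambda>x. (F x - \<mu>)\<^sup>2)" by (rule second_moment_about(2)[OF F])
    fix x
    have "x \<in> B \<Longrightarrow> \<bar>\<mu> - m\<bar> \<le> \<bar>F x - \<mu>\<bar>" by (auto simp: B_def split: if_splits)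
    then show "(\<mu> - m)\<^sup>2 * indicator B x \<le> (F x - \<mu>)\<^sup>2"
      by (auto simp: indicator_def abs_le_square_iff)
  qed
  also have "\<dots> = gauss_var n F" using second_moment_about(1)[OF F, of \<mu>] by (simp add: \<mu>_def)
  finally show ?thesis by (simp add: \<mu>_def)
qed

lemma second_moment_le_gauss_var:
  assumes F: "convex_lip n L F" and m: "is_median (gauss n) F m"
  shows "(\<integral>x. (F x - m)\<^sup>2 \<partial>gauss n) \<le> 3 * gauss_var n F"
  using second_moment_about(1)[OF F, of m] median_mean[OF F m] by simp

lemma markov_powr:
  assumes F: "convex_lip n L F" and p: "0 < p" and r: "0 < r"
  shows "r powr p * measure (gauss n) {x\<in>space (gauss n). r \<le> \<bar>F x - m\<bar>} \<le> (\<integral>x. \<bar>F x - m\<bar> powr p \<partial>gauss n)"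
proof -
  interpret g: prob_space "gauss n" by (rule prob_space_gauss)
  have mF[measurable]: "F \<in> borel_measurable (gauss n)" by (rule convex_lip_measurable_gauss[OF F])
  let ?B = "{x\<in>space (gauss n). r \<le> \<bar>F x - m\<bar>}"
  have B: "?B \<in> sets (gauss n)" by simp
  have int: "integrable (gauss n) (\<lambda>x. \<bar>F x - m\<bar> powr p)"
  proof (rule integrable_gaussI[where C = "p * (\<bar>F (\<lambda>_. 0)\<bar> + \<bar>m\<bar>)" and c = "p * L"])
    show "(\<lambda>x. \<bar>F x - m\<bar> powr p) \<in> borel_measurable (gauss n)" by measurable
    fix x
    have "\<bar>F x - F (\<lambda>_. 0)\<bar> \<le> L * l1 n x"
      using convex_lipD(2)[OF F, of x "\<lambda>_. 0"] mult_left_mono[OF L2_set_le_l1[of x n] convex_lipD(1)[OF F]] by simp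
    then have "\<bar>F x - m\<bar> \<le> \<bar>F (\<lambda>_. 0)\<bar> + \<bar>m\<bar> + L * l1 n x" by linarith
    also have "\<dots> \<le> exp (\<bar>F (\<lambda>_. 0)\<bar> + \<bar>m\<bar> + L * l1 n x)" by (rule self_le_exp)
    finally have "\<bar>F x - m\<bar> powr p \<le> exp (\<bar>F (\<lambda>_. 0)\<bar> + \<bar>m\<bar> + L * l1 n x) powr p"
      using p by (intro powr_mono2) auto
    then show "\<bar>\<bar>F x - m\<bar> powr p\<bar> \<le> exp (p * (\<bar>F (\<lambda>_. 0)\<bar> + \<bar>m\<bar>) + p * L * l1 n x)"
      by (simp add: powr_def algebra_simps)
  qed
  have "r powr p * measure (gauss n) ?B = (\<integral>x. r powr p * indicator ?B x \<partial>gauss n)" using B by simp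
  also have "\<dots> \<le> (\<integral>x. \<bar>F x - m\<bar> powr p \<partial>gauss n)"
  proof (rule integral_mono[OF _ int])
    show "integrable (gauss n) (\<lambda>x. r powr p * indicator ?B x)"
      by (intro integrable_mult_right integrable_real_indicator B) (simp add: less_top[symmetric])
    fix x
    show "r powr p * indicator ?B x \<le> \<bar>F x - m\<bar> powr p"
      using p r by (auto simp: indicator_def intro: powr_mono2)
  qed
  finally show ?thesis .
qed

lemma variance_eq_gauss_var:
  assumes F: "convex_lip n L F" and eq: "\<And>x. x \<in> space (gauss n) \<Longrightarrow> F x = f x"
  shows "prob_space.variance (gauss n) f = gauss_var n F"
proof -
  have e: "(\<integral>x. f x \<partial>gauss n) = (\<integral>x. F x \<partial>gauss n)"
    by (intro Bochner_Integration.integral_cong refl) (simp add: eq)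
  have "prob_space.variance (gauss n) f = (\<integral>x. (F x - (\<integral>x. F x \<partial>gauss n))\<^sup>2 \<partial>gauss n)"
    unfolding e by (intro Bochner_Integration.integral_cong refl) (simp add: eq)
  then show ?thesis using second_moment_about(1)[OF F, of "\<integral>x. F x \<partial>gauss n"] by simp
qed

section \<open>The implications between the three conditions\<close>

text \<open>Markov's inequality at the level \<open>sqrt p * Lip n f\<close>: there the tail bound
  is \<open>a\<close> times the \<open>p\<close>-th power of \<open>exp (- 1 / A\<^sup>2)\<close>,
  so the \<open>p\<close>-th root leaves constants free of \<open>p\<close>. \<open>min 1 a\<close>
  bounds all roots \<open>a powr (1 / p)\<close> from below.\<close>

lemma tail_imp_moment:
  assumes adm: "admissible n f m" and tail: "tail_bound n f m a A" and a: "0 < a" and A: "0 < A"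
  shows "moment_bound n f m (min 1 a * exp (- 1 / A\<^sup>2))"
proof -
  obtain F where F: "convex_lip n (Lip n f) F" and eq: "\<And>x. x \<in> space (gauss n) \<Longrightarrow> F x = f x"
    using admissible_extension[OF adm] by metis
  have T: "{z\<in>space (gauss n). \<bar>f z - m\<bar> \<ge> r} = {z\<in>space (gauss n). r \<le> \<bar>F z - m\<bar>}" for r
    using eq by auto
  define L where "L = Lip n f"
  have L: "0 \<le> L" unfolding L_def by (rule convex_lipD(1)[OF F])
  show ?thesis
    unfolding moment_bound_def L_def[symmetric]
  proof (intro allI impI)
    fix p :: real assume p: "2 \<le> p"
    have E: "(\<integral>z. \<bar>f z - m\<bar> powr p \<partial>gauss n) = (\<integral>z. \<bar>F z - m\<bar> powr p \<partial>gauss n)"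
      by (intro Bochner_Integration.integral_cong refl) (simp add: eq)
    show "min 1 a * exp (- 1 / A\<^sup>2) * sqrt p * L \<le> (\<integral>z. \<bar>f z - m\<bar> powr p \<partial>gauss n) powr (1 / p)"
    proof (cases "L = 0")
      case False
      then have L: "0 < L" using L by simp
      let ?r = "sqrt p * L"
      have r: "0 < ?r" using L p by simp
      have "a * exp (- p / A\<^sup>2) \<le> measure (gauss n) {z\<in>space (gauss n). ?r \<le> \<bar>F z - m\<bar>}"
        using tail p unfolding tail_bound_def T L_def[symmetric]
        by (elim allE[where x = "sqrt p"]) simp
      then have "?r powr p * (a * exp (- p / A\<^sup>2)) \<le> (\<integral>z. \<bar>F z - m\<bar> powr p \<partial>gauss n)"
        using markov_powr[OF F _ r, of p m] p by (meson less_le_trans mult_left_mono order_trans powr_ge_zero zero_less_numeral)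
      then have "(?r powr p * (a * exp (- p / A\<^sup>2))) powr (1 / p) \<le> (\<integral>z. \<bar>F z - m\<bar> powr p \<partial>gauss n) powr (1 / p)"
        using p a by (intro powr_mono2) auto
      moreover have "(?r powr p * (a * exp (- p / A\<^sup>2))) powr (1 / p) = ?r * (a powr (1 / p) * exp (- 1 / A\<^sup>2))"
      proof -
        have "(?r powr p) powr (1 / p) = ?r" using r p by (simp add: powr_powr)
        moreover have "exp (- p / A\<^sup>2) powr (1 / p) = exp (- 1 / A\<^sup>2)" using p by (simp add: powr_def)
        ultimately show ?thesis using a r by (simp only: powr_mult)
      qed
      moreover have "min 1 a \<le> a powr (1 / p)"
      proof (cases "1 \<le> a")
        case True
        then show ?thesis using p ge_one_powr_ge_zero[of a "1 / p"] by simp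
      next
        case False
        then have "a powr 1 \<le> a powr (1 / p)" using p a by (intro powr_mono') auto
        then show ?thesis using False a by simp
      qed
      then have "?r * (min 1 a * exp (- 1 / A\<^sup>2)) \<le> ?r * (a powr (1 / p) * exp (- 1 / A\<^sup>2))"
        using r by (intro mult_left_mono mult_right_mono) auto
      ultimately show ?thesis unfolding E by (simp add: mult_ac)
    qed simp
  qed
qed

text \<open>The single level \<open>t = 1\<close> bounds the second moment about the median from
  below; passing to the variance costs the factor 3.\<close>

lemma tail_imp_variance:
  assumes adm: "admissible n f m" and tail: "tail_bound n f m a A" and a: "0 < a"
  shows "variance_bound n f (sqrt (a * exp (- 1 / A\<^sup>2) / 3))"
proof -
  obtain F where F: "convex_lip n (Lip n f) F" and eq: "\<And>x. x \<in> space (gauss n) \<Longrightarrow> F x = f x"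
    and m: "is_median (gauss n) F m"
    using admissible_extension[OF adm] by metis
  have T: "{z\<in>space (gauss n). \<bar>f z - m\<bar> \<ge> r} = {z\<in>space (gauss n). r \<le> \<bar>F z - m\<bar>}" for r
    using eq by auto
  have V: "prob_space.variance (gauss n) f = gauss_var n F"
    by (rule variance_eq_gauss_var[OF F]) (rule eq)
  define L where "L = Lip n f"
  have L: "0 \<le> L" unfolding L_def by (rule convex_lipD(1)[OF F])
  have "a * exp (- 1 / A\<^sup>2) * L\<^sup>2 \<le> 3 * gauss_var n F"
  proof (cases "L = 0")
    case True
    then show ?thesis
      using second_moment_about(1)[OF F, of "\<integral>x. F x \<partial>gauss n", symmetric] by (simp add: integral_nonneg)
  next
    case False
    then have L: "0 < L" using L by simp
    have "a * exp (- 1 / A\<^sup>2) \<le> measure (gauss n) {z\<in>space (gauss n). L \<le> \<bar>F z - m\<bar>}"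
      using tail unfolding tail_bound_def T L_def[symmetric]
      by (elim allE[where x = 1]) simp
    then have "L\<^sup>2 * (a * exp (- 1 / A\<^sup>2)) \<le> L powr 2 * measure (gauss n) {z\<in>space (gauss n). L \<le> \<bar>F z - m\<bar>}"
      using L by (simp add: mult_left_mono)
    also have "\<dots> \<le> (\<integral>x. \<bar>F x - m\<bar> powr 2 \<partial>gauss n)" by (rule markov_powr[OF F _ L]) simp
    also have "\<dots> = (\<integral>x. (F x - m)\<^sup>2 \<partial>gauss n)" by simp
    also have "\<dots> \<le> 3 * gauss_var n F" by (rule second_moment_le_gauss_var[OF F m])
    finally show ?thesis by (simp add: mult.commute)
  qed
  then show ?thesis
    unfolding variance_bound_def V using a by (simp add: L_def)
qed

lemma moment_imp_variance:
  assumes adm: "admissible n f m" and mom: "moment_bound n f m A" and A: "0 < A"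
  shows "variance_bound n f (A * sqrt (2 / 3))"
proof -
  obtain F where F: "convex_lip n (Lip n f) F" and eq: "\<And>x. x \<in> space (gauss n) \<Longrightarrow> F x = f x"
    and m: "is_median (gauss n) F m"
    using admissible_extension[OF adm] by metis
  have V: "prob_space.variance (gauss n) f = gauss_var n F"
    by (rule variance_eq_gauss_var[OF F]) (rule eq)
  define L where "L = Lip n f"
  have L: "0 \<le> L" unfolding L_def by (rule convex_lipD(1)[OF F])
  have E: "(\<integral>z. \<bar>f z - m\<bar> powr 2 \<partial>gauss n) = (\<integral>z. (F z - m)\<^sup>2 \<partial>gauss n)"
    by (intro Bochner_Integration.integral_cong refl) (simp add: eq)
  have "A * sqrt 2 * L \<le> (\<integral>z. (F z - m)\<^sup>2 \<partial>gauss n) powr (1 / 2)"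
    using mom[unfolded moment_bound_def, rule_format, of 2] unfolding E L_def by simp
  also have "\<dots> = sqrt (\<integral>z. (F z - m)\<^sup>2 \<partial>gauss n)" by (rule powr_half_sqrt) simp
  finally have "(A * sqrt 2 * L)\<^sup>2 \<le> (sqrt (\<integral>z. (F z - m)\<^sup>2 \<partial>gauss n))\<^sup>2"
    using A L by (intro power_mono) auto
  then have "2 * A\<^sup>2 * L\<^sup>2 \<le> 3 * gauss_var n F"
    using second_moment_le_gauss_var[OF F m] by (simp add: power_mult_distrib)
  then show ?thesis
    unfolding variance_bound_def V by (simp add: L_def power_mult_distrib)
qed

lemma variance_imp_tail:
  assumes A: "0 < A"
  obtains a\<^sub>1 A\<^sub>1 :: real where "0 < a\<^sub>1" "0 < A\<^sub>1"
    "\<And>n f m. admissible n f m \<Longrightarrow> variance_bound n f A \<Longrightarrow> tail_bound n f m a\<^sub>1 A\<^sub>1"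
proof -
  define \<kappa> where "\<kappa> = A ^ 3 / 4096"
  have \<kappa>: "0 < \<kappa>" using A by (simp add: \<kappa>_def)
  define K where "K = 65 / \<kappa> + 1"
  have K: "0 < K" using \<kappa> by (simp add: K_def add_pos_pos)
  \<comment> \<open>The exponent \<open>K * t\<^sup>2\<close> at
    \<open>t = s / \<kappa> + (16 / \<kappa> + 1)\<close> is split by \<open>square_sum_le\<close>:
    the part with \<open>s\<close> yields the rate \<open>A\<^sub>1\<close>, the constant part is
    \<open>B\<close> and goes into \<open>a\<^sub>1\<close>.\<close>
  define B where "B = 2 * K * (16 / \<kappa> + 1)\<^sup>2"
  \<comment> \<open>The minimum with 1 serves the case \<open>L = 0\<close>, where the tail event is
    the whole space.\<close>
  define a\<^sub>1 where "a\<^sub>1 = min 1 (\<kappa>\<^sup>2 / 600 * exp (- B))"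
  define A\<^sub>1 where "A\<^sub>1 = \<kappa> / sqrt (2 * K)"
  have pos: "0 < a\<^sub>1" "0 < A\<^sub>1" using \<kappa> K by (auto simp: a\<^sub>1_def A\<^sub>1_def)
  have A1: "1 / A\<^sub>1\<^sup>2 = 2 * K / \<kappa>\<^sup>2" using K by (simp add: A\<^sub>1_def power_divide)
  have "tail_bound n f m a\<^sub>1 A\<^sub>1" if adm: "admissible n f m" and var: "variance_bound n f A" for n f m
  proof -
    obtain F where F: "convex_lip n (Lip n f) F" and eq: "\<And>x. x \<in> space (gauss n) \<Longrightarrow> F x = f x"
      and m: "is_median (gauss n) F m"
      using admissible_extension[OF adm] by metis
  have T: "{z\<in>space (gauss n). \<bar>f z - m\<bar> \<ge> r} = {z\<in>space (gauss n). r \<le> \<bar>F z - m\<bar>}" for r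
    using eq by auto
  have V: "prob_space.variance (gauss n) f = gauss_var n F"
    by (rule variance_eq_gauss_var[OF F]) (rule eq)
    interpret g: prob_space "gauss n" by (rule prob_space_gauss)
    have mF[measurable]: "F \<in> borel_measurable (gauss n)" by (rule convex_lip_measurable_gauss[OF F])
    define L where "L = Lip n f"
    note F = F[folded L_def]
    have L: "0 \<le> L" by (rule convex_lipD(1)[OF F])
    show ?thesis
      unfolding tail_bound_def T L_def[symmetric]
    proof (intro allI impI)
      fix s :: real assume s: "0 < s"
      show "a\<^sub>1 * exp (- s\<^sup>2 / A\<^sub>1\<^sup>2) \<le> measure (gauss n) {z\<in>space (gauss n). s * L \<le> \<bar>F z - m\<bar>}"
      proof (cases "L = 0")
        case True
        have "a\<^sub>1 * exp (- s\<^sup>2 / A\<^sub>1\<^sup>2) \<le> 1 * 1" using pos by (intro mult_mono) (auto simp: a\<^sub>1_def)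
        then show ?thesis using True g.prob_space by simp
      next
        case False
        then have L: "0 < L" using L by simp
        interpret dev: gaussian_deviation n L A F
          using F L A var[unfolded variance_bound_def V] by unfold_locales (auto simp: L_def)
        have k: "dev.\<kappa> = \<kappa>" by (simp add: dev.\<kappa>_def \<kappa>_def)
        \<comment> \<open>Chosen so that \<open>\<kappa> * t = s + 16 + \<kappa>\<close>: the 16
          pays for the distance between mean and median, and the summand 1 ensures
          \<open>t \<ge> 1\<close> however small \<open>s\<close> is.\<close>
        define t where "t = (s + 16) / \<kappa> + 1"
        have t: "1 \<le> t" using s \<kappa> by (simp add: t_def)
        \<comment> \<open>The 16 arises as the square root of 2 times 128, from
          \<open>median_mean\<close> and \<open>gauss_var_le\<close>.\<close>
        have "(dev.\<mu> - m)\<^sup>2 \<le> (16 * L)\<^sup>2"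
          using median_mean[OF F m] gauss_var_le[OF F] by (simp add: dev.\<mu>_def power_mult_distrib)
        then have "\<bar>dev.\<mu> - m\<bar> \<le> \<bar>16 * L\<bar>" by (simp only: abs_le_square_iff)
        then have mu: "\<bar>dev.\<mu> - m\<bar> \<le> 16 * L" using L by simp
        have "t\<^sup>2 = (s / \<kappa> + (16 / \<kappa> + 1))\<^sup>2" by (simp add: t_def add_divide_distrib add_ac)
        also have "\<dots> \<le> 2 * (s / \<kappa>)\<^sup>2 + 2 * (16 / \<kappa> + 1)\<^sup>2" by (rule square_sum_le)
        finally have "K * t\<^sup>2 \<le> K * (2 * (s / \<kappa>)\<^sup>2 + 2 * (16 / \<kappa> + 1)\<^sup>2)" using K by (intro mult_left_mono) auto
        also have "\<dots> = B + s\<^sup>2 * (2 * K / \<kappa>\<^sup>2)" by (simp add: B_def power_divide distrib_left)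
        finally have Kt: "- B + - s\<^sup>2 / A\<^sub>1\<^sup>2 \<le> - K * t\<^sup>2" using A1 by (simp add: divide_inverse)
        have "a\<^sub>1 * exp (- s\<^sup>2 / A\<^sub>1\<^sup>2) \<le> \<kappa>\<^sup>2 / 600 * exp (- B) * exp (- s\<^sup>2 / A\<^sub>1\<^sup>2)"
          by (intro mult_right_mono) (auto simp: a\<^sub>1_def)
        also have "\<dots> = \<kappa>\<^sup>2 / 600 * exp (- B + - s\<^sup>2 / A\<^sub>1\<^sup>2)" by (simp only: exp_add mult.assoc)
        also have "\<dots> \<le> \<kappa>\<^sup>2 / 600 * exp (- K * t\<^sup>2)"
          using Kt by (intro mult_left_mono) (simp_all only: exp_le_cancel_iff, simp)
        also have "\<dots> \<le> measure (gauss n) {x\<in>space (gauss n). dev.\<mu> + \<kappa> * t * L \<le> F x}"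
          using dev.upper_tail[OF t] unfolding k K_def .
        also have "\<dots> \<le> measure (gauss n) {z\<in>space (gauss n). s * L \<le> \<bar>F z - m\<bar>}"
        proof (rule g.finite_measure_mono)
          have "\<kappa> * t = s + 16 + \<kappa>" using \<kappa> by (simp add: t_def field_simps)
          then have "\<kappa> * t * L = s * L + 16 * L + \<kappa> * L" by (simp add: algebra_simps)
          moreover have "0 < \<kappa> * L" using \<kappa> L by simp
          ultimately have "s * L \<le> dev.\<mu> + \<kappa> * t * L - m" using mu by linarith
          then show "{x\<in>space (gauss n). dev.\<mu> + \<kappa> * t * L \<le> F x} \<subseteq> {z\<in>space (gauss n). s * L \<le> \<bar>F z - m\<bar>}"
            by auto
        qed measurable
        finally show ?thesis .
      qed
    qed
  qed
  then show thesis using pos that by blast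
qed

text \<open>(b) reaches (a) through (c), and (c) reaches (b) through (a). Choosing the constants
  before \<open>n\<close>, \<open>f\<close> and \<open>m\<close> expresses that they depend on
  neither dimension nor function; \<open>m\<close> ranges over every median.\<close>

theorem corollary2p9:
  shows
    "(\<forall>a\<^sub>1>0. \<forall>A\<^sub>1>0. \<exists>A\<^sub>2>0. \<exists>A\<^sub>3>0. \<forall>n f m. admissible n f m \<longrightarrow>
        tail_bound n f m a\<^sub>1 A\<^sub>1 \<longrightarrow> moment_bound n f m A\<^sub>2 \<and> variance_bound n f A\<^sub>3) \<and>
     (\<forall>A\<^sub>2>0. \<exists>a\<^sub>1>0. \<exists>A\<^sub>1>0. \<exists>A\<^sub>3>0. \<forall>n f m. admissible n f m \<longrightarrow>
        moment_bound n f m A\<^sub>2 \<longrightarrow> tail_bound n f m a\<^sub>1 A\<^sub>1 \<and> variance_bound n f A\<^sub>3) \<and>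
     (\<forall>A\<^sub>3>0. \<exists>a\<^sub>1>0. \<exists>A\<^sub>1>0. \<exists>A\<^sub>2>0. \<forall>n f m. admissible n f m \<longrightarrow>
        variance_bound n f A\<^sub>3 \<longrightarrow> tail_bound n f m a\<^sub>1 A\<^sub>1 \<and> moment_bound n f m A\<^sub>2)"
proof (intro conjI allI impI)
  fix a\<^sub>1 A\<^sub>1 :: real assume *: "0 < a\<^sub>1" "0 < A\<^sub>1"
  have "0 < min 1 a\<^sub>1 * exp (- 1 / A\<^sub>1\<^sup>2)" "0 < sqrt (a\<^sub>1 * exp (- 1 / A\<^sub>1\<^sup>2) / 3)" using * by auto
  then show "\<exists>A\<^sub>2>0. \<exists>A\<^sub>3>0. \<forall>n f m. admissible n f m \<longrightarrow>
        tail_bound n f m a\<^sub>1 A\<^sub>1 \<longrightarrow> moment_bound n f m A\<^sub>2 \<and> variance_bound n f A\<^sub>3"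
    using tail_imp_moment[OF _ _ *] tail_imp_variance[OF _ _ *(1)] by blast
next
  fix A\<^sub>2 :: real assume *: "0 < A\<^sub>2"
  define A\<^sub>3 where "A\<^sub>3 = A\<^sub>2 * sqrt (2 / 3)"
  have A3: "0 < A\<^sub>3" using * by (simp add: A\<^sub>3_def)
  have var: "variance_bound n f A\<^sub>3" if "admissible n f m" "moment_bound n f m A\<^sub>2" for n f m
    unfolding A\<^sub>3_def by (rule moment_imp_variance[OF that *])
  obtain a\<^sub>1 A\<^sub>1 where "0 < a\<^sub>1" "0 < A\<^sub>1"
    "\<And>n f m. admissible n f m \<Longrightarrow> variance_bound n f A\<^sub>3 \<Longrightarrow> tail_bound n f m a\<^sub>1 A\<^sub>1"
    using variance_imp_tail[OF A3] by blast
  then show "\<exists>a\<^sub>1>0. \<exists>A\<^sub>1>0. \<exists>A\<^sub>3>0. \<forall>n f m. admissible n f m \<longrightarrow>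
        moment_bound n f m A\<^sub>2 \<longrightarrow> tail_bound n f m a\<^sub>1 A\<^sub>1 \<and> variance_bound n f A\<^sub>3"
    using var A3 by blast
next
  fix A\<^sub>3 :: real assume *: "0 < A\<^sub>3"
  obtain a\<^sub>1 A\<^sub>1 where 1: "0 < a\<^sub>1" "0 < A\<^sub>1"
    and tail: "\<And>n f m. admissible n f m \<Longrightarrow> variance_bound n f A\<^sub>3 \<Longrightarrow> tail_bound n f m a\<^sub>1 A\<^sub>1"
    using variance_imp_tail[OF *] by blast
  have "0 < min 1 a\<^sub>1 * exp (- 1 / A\<^sub>1\<^sup>2)" using 1 by auto
  then show "\<exists>a\<^sub>1>0. \<exists>A\<^sub>1>0. \<exists>A\<^sub>2>0. \<forall>n f m. admissible n f m \<longrightarrow>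
        variance_bound n f A\<^sub>3 \<longrightarrow> tail_bound n f m a\<^sub>1 A\<^sub>1 \<and> moment_bound n f m A\<^sub>2"
    using 1 tail tail_imp_moment[OF _ _ 1] by blast
qed

end
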